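(* Let $\Bbbk$ be a field with $\operatorname{char}(\Bbbk)=0$ and let $m,n\geq 1$ be integers. Then the algebra $A(L_{m,n})$ associated to the lollipop graph $L_{m,n}$ has the weak Lefschetz property if and only if one of the following holds: (i) $m=1$ and $n\in\{1,2,3,4,5,6,8,9,12\}$; (ii) $m=2$ and $n\in\{1,2,3,4,5,7,8,11\}$; (iii) $m\geq 3$ and $n\in\{1,3,4,7\}$.
   Context: For integers $m,n\ge 1$, the lollipop graph $L_{m,n}$ is the simple graph formed by attaching a complete graph $K_m$ to a path $P_n$ (on $n$ vertices) by a bridge: its vertices are $x_1,\ldots,x_m,y_1,\ldots,y_n$, and its edges are $\{x_i,x_j\}$ for $1\le i<j\le m$, $\{x_m,y_1\}$, and $\{y_j,y_{j+1}\}$ for $1\le j\le n-1$. For a simple graph $G$ with vertex set $\{1,\ldots,N\}$ and edge set $E$, let $R=\Bbbk[z_1,\ldots,z_N]$ be the standard graded polynomial ring (one variable per vertex), let $I(G)=(z_iz_j\mid \{i,j\}\in E)\subset R$ be the edge ideal, and set \[ A(G)=\frac{R}{(z_1^2,\ldots,z_N^2)+I(G)}, \] the Artinian algebra associated to $G$. A standard graded Artinian $\Bbbk$-algebra $A=\bigoplus_{i=0}^D[A]_i$ has the weak Lefschetz property (WLP) if there is a linear form $\ell\in[A]_1$ such that for every integer $j$ the multiplication map $\cdot\ell:[A]_j\to[A]_{j+1}$ has maximal rank, i.e. is injective or surjective. *)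

theory Defs
  imports "HOL-Algebra.QuotRing" "HOL-Library.Poly_Mapping"
begin

type_synonym ('v, 'k) mpoly = "('v \<Rightarrow>\<^sub>0 nat) \<Rightarrow>\<^sub>0 'k"

text \<open>The type of finitely supported functions already carries the polynomial ring operations;
  the record below restricts it to the polynomials whose variables lie in \<open>V\<close>.\<close>

definition poly_ring :: "'v set \<Rightarrow> ('v, 'k::comm_ring_1) mpoly ring" where
  "poly_ring V =
     \<lparr>carrier = {p. \<forall>t \<in> Poly_Mapping.keys p. Poly_Mapping.keys t \<subseteq> V},
      mult = (*), one = 1, zero = 0, add = (+)\<rparr>"

lemma cring_poly_ring: "cring (poly_ring V :: ('v, 'k::comm_ring_1) mpoly ring)"
proof -
  define C :: "('v, 'k) mpoly set"
    where "C = {p. \<forall>t \<in> Poly_Mapping.keys p. Poly_Mapping.keys t \<subseteq> V}"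
  have R: "poly_ring V = \<lparr>carrier = C, mult = (*), one = 1, zero = 0, add = (+)\<rparr>"
    by (simp add: poly_ring_def C_def)
  have mem: "p \<in> C \<longleftrightarrow> (\<forall>t \<in> Poly_Mapping.keys p. Poly_Mapping.keys t \<subseteq> V)" for p
    by (simp add: C_def)
  have zero: "0 \<in> C" and one: "1 \<in> C"
    by (simp_all add: mem)
  have add: "p + q \<in> C" if "p \<in> C" "q \<in> C" for p q
    using that Poly_Mapping.keys_add[of p q] unfolding mem by blast
  have neg: "- p \<in> C" if "p \<in> C" for p
    using that by (simp add: mem)
  have mul: "p * q \<in> C" if "p \<in> C" "q \<in> C" for p q
    unfolding mem
  proof
    fix t assume "t \<in> Poly_Mapping.keys (p * q)"
    then obtain a b where t: "t = a + b"
      and a: "a \<in> Poly_Mapping.keys p" and b: "b \<in> Poly_Mapping.keys q"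
      using keys_mult[of p q] by blast
    have "Poly_Mapping.keys a \<subseteq> V" "Poly_Mapping.keys b \<subseteq> V"
      using that a b unfolding mem by blast+
    then show "Poly_Mapping.keys t \<subseteq> V"
      using Poly_Mapping.keys_add[of a b] unfolding t by blast
  qed
  have ex_neg: "\<exists>q \<in> C. p + q = 0" if "p \<in> C" for p
    using neg[OF that] by (intro bexI[of _ "- p"]) simp_all
  have "abelian_group (poly_ring V :: ('v, 'k) mpoly ring)"
    unfolding R by (rule abelian_groupI) (simp_all add: zero add ex_neg ac_simps)
  moreover have "Group.comm_monoid (poly_ring V :: ('v, 'k) mpoly ring)"
    unfolding R by (rule comm_monoidI) (simp_all add: one mul ac_simps)
  ultimately show ?thesis
    by (rule cringI) (simp add: R distrib_right)
qed

definition var :: "'v \<Rightarrow> ('v, 'k::comm_ring_1) mpoly" where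
  "var v = Poly_Mapping.single (Poly_Mapping.single v 1) 1"

definition monom_degree :: "('v \<Rightarrow>\<^sub>0 nat) \<Rightarrow> nat" where
  "monom_degree t = (\<Sum>v \<in> Poly_Mapping.keys t. Poly_Mapping.lookup t v)"

text \<open>Degrees are integers; in a negative degree only the zero polynomial is homogeneous.\<close>

definition homogeneous :: "int \<Rightarrow> ('v, 'k::comm_ring_1) mpoly \<Rightarrow> bool" where
  "homogeneous j p \<longleftrightarrow> (\<forall>t \<in> Poly_Mapping.keys p. int (monom_degree t) = j)"

text \<open>A simple graph is given by its vertex set \<open>V\<close> and its set \<open>E\<close> of two-element
  subsets of \<open>V\<close>.\<close>

definition edge_ideal :: "'v set \<Rightarrow> 'v set set \<Rightarrow> ('v, 'k::comm_ring_1) mpoly set" where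
  "edge_ideal V E = Idl\<^bsub>poly_ring V\<^esub> {var u * var v | u v. {u, v} \<in> E}"

definition graph_relations :: "'v set \<Rightarrow> 'v set set \<Rightarrow> ('v, 'k::comm_ring_1) mpoly set" where
  "graph_relations V E =
     (Idl\<^bsub>poly_ring V\<^esub> {var v ^ 2 | v. v \<in> V}) <+>\<^bsub>poly_ring V\<^esub> edge_ideal V E"

definition graph_algebra :: "'v set \<Rightarrow> 'v set set \<Rightarrow> ('v, 'k::comm_ring_1) mpoly set ring" where
  "graph_algebra V E = poly_ring V Quot graph_relations V E"

definition graph_algebra_component ::
    "'v set \<Rightarrow> 'v set set \<Rightarrow> int \<Rightarrow> ('v, 'k::comm_ring_1) mpoly set set" where
  "graph_algebra_component V E j =
     {graph_relations V E +>\<^bsub>poly_ring V\<^esub> p | p. p \<in> carrier (poly_ring V) \<and> homogeneous j p}"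

text \<open>The argument \<open>gr\<close> gives the homogeneous components of the graded algebra \<open>A\<close>.\<close>

definition weak_lefschetz :: "('a, 'b) ring_scheme \<Rightarrow> (int \<Rightarrow> 'a set) \<Rightarrow> bool" where
  "weak_lefschetz A gr \<longleftrightarrow>
     (\<exists>l \<in> gr 1. \<forall>j. inj_on (\<lambda>a. l \<otimes>\<^bsub>A\<^esub> a) (gr j) \<or> (\<lambda>a. l \<otimes>\<^bsub>A\<^esub> a) ` gr j = gr (j + 1))"

datatype lollipop_vertex = X nat | Y nat

definition lollipop_vertices :: "nat \<Rightarrow> nat \<Rightarrow> lollipop_vertex set" where
  "lollipop_vertices m n = X ` {1..m} \<union> Y ` {1..n}"

definition lollipop_edges :: "nat \<Rightarrow> nat \<Rightarrow> lollipop_vertex set set" where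
  "lollipop_edges m n =
     {{X i, X j} | i j. 1 \<le> i \<and> i < j \<and> j \<le> m} \<union> {{X m, Y 1}} \<union>
     {{Y j, Y (j + 1)} | j. 1 \<le> j \<and> j + 1 \<le> n}"

end

theory Submission
  imports Defs
begin

text \<open>
  In the basis of the monomials \<open>x\<^sub>S\<close>, \<open>S\<close> an independent set, an element of degree \<open>j\<close> of the
  algebra of a graph is a function \<open>f\<close> on the independent sets of size \<open>j\<close>, and
  multiplication by \<open>\<ell> = \<Sum>\<^sub>v a\<^sub>v x\<^sub>v\<close> sends \<open>f\<close> to \<open>T \<mapsto> \<Sum>\<^bsub>v \<in> T\<^esub> a\<^sub>v f(T - v)\<close>.
  So maximal rank in degree \<open>j\<close> means that this map of functions on the independence complex
  or its transpose has trivial kernel (\<open>weak_lefschetz_graph_algebra_iff\<close>,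
  \<open>mult_surjective_iff_coker_trivial\<close>). A kernel vector for \<open>a = 1\<close> can be rescaled, and
  degenerated where some \<open>a\<^sub>v\<close> vanish, to a kernel vector for \<open>a\<close>; hence \<open>a = 1\<close> is the best
  choice (\<open>ker_trivial_imp_all_ones\<close>, \<open>coker_trivial_imp_all_ones\<close>).

  For the path on \<open>N\<close> vertices the two kernels are governed by \<open>4 j\<close> and \<open>3 j\<close>. Multiplication by
  \<open>\<ell>\<close> is injective in degree \<open>j\<close> if \<open>N \<ge> 4 j + 1\<close> and surjective onto degree \<open>j + 1\<close> if
  \<open>N \<le> 3 j + 1\<close>. Both follow by splitting off the last vertex, once they are extended to all powers
  of \<open>\<ell>\<close>: the relation between the two parts of a kernel vector then trades one power of \<open>\<ell>\<close>
  against one vertex (\<open>path_power_injective\<close>, \<open>path_power_coinjective\<close>). Conversely, if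
  \<open>4 j - 3 \<le> N \<le> 4 j\<close>, the product over consecutive quadruples of
  \<open>(x\<^sub>1 + x\<^sub>2) - (x\<^sub>3 + x\<^sub>4)\<close> is killed by \<open>\<ell>\<close>, because \<open>x\<^sub>1 + x\<^sub>2\<close> and \<open>x\<^sub>3 + x\<^sub>4\<close> have square
  zero; and if \<open>N \<ge> 3 j + 2\<close>, an induced matching with \<open>j + 1\<close> edges \<open>{u, v}\<close> gives the product of
  the \<open>x\<^sub>u - x\<^sub>v\<close>, which the transpose kills (\<open>not_ker_trivial_path\<close>, \<open>not_coker_trivial_path\<close>).

  The clique of the lollipop minus its bridge vertex behaves like one vertex: with
  \<open>N = n + min m 2\<close>, the kernel in degree \<open>j\<close> is trivial for the lollipop iff it is for the path on
  \<open>N\<close> vertices. The transposed kernels also agree if \<open>m \<le> 2\<close>. If \<open>m \<ge> 3\<close>, a difference of two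
  clique vertices can serve as one more matching edge, which costs no vertex of the tail, and
  surjectivity holds exactly for \<open>n + 2 \<le> 3 j\<close>.

  The weak Lefschetz property therefore fails iff some \<open>j\<close> has \<open>N \<le> 4 j\<close> and is too small for
  surjectivity. The smallest \<open>j\<close> with \<open>N \<le> 4 j\<close> decides, and for it surjectivity bounds \<open>N\<close> by \<open>13\<close>
  if \<open>m \<le> 2\<close> and by \<open>9\<close> if \<open>m \<ge> 3\<close>; the three lists are the solutions.
\<close>

section \<open>Multiplication by a linear form on a simplicial complex\<close>

definition link_vertices :: "'v set set \<Rightarrow> 'v set \<Rightarrow> 'v set" where
  "link_vertices \<Delta> R = {v. v \<notin> R \<and> insert v R \<in> \<Delta>}"

text \<open>A function \<open>f\<close> stands for the element \<open>\<Sum> f(S) x\<^sub>S\<close> over the faces \<open>S\<close> of size \<open>j\<close>; the values of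
  \<open>f\<close> elsewhere are irrelevant. The next two properties say that multiplication by
  \<open>\<Sum> a\<^sub>v x\<^sub>v\<close>, from degree \<open>j\<close> to degree \<open>j + 1\<close>, and its transpose are injective.\<close>

definition ker_trivial :: "('v \<Rightarrow> 'k::field) \<Rightarrow> 'v set set \<Rightarrow> nat \<Rightarrow> bool" where
  "ker_trivial a \<Delta> j \<longleftrightarrow>
     (\<forall>f. (\<forall>T\<in>\<Delta>. card T = Suc j \<longrightarrow> (\<Sum>v\<in>T. a v * f (T - {v})) = 0)
        \<longrightarrow> (\<forall>S\<in>\<Delta>. card S = j \<longrightarrow> f S = 0))"

definition coker_trivial :: "('v \<Rightarrow> 'k::field) \<Rightarrow> 'v set set \<Rightarrow> nat \<Rightarrow> bool" where
  "coker_trivial a \<Delta> j \<longleftrightarrow>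
     (\<forall>\<phi>. (\<forall>R\<in>\<Delta>. card R = j \<longrightarrow> (\<Sum>v\<in>link_vertices \<Delta> R. a v * \<phi> (insert v R)) = 0)
        \<longrightarrow> (\<forall>S\<in>\<Delta>. card S = Suc j \<longrightarrow> \<phi> S = 0))"

definition mult_surjective :: "('v \<Rightarrow> 'k::field) \<Rightarrow> 'v set set \<Rightarrow> nat \<Rightarrow> bool" where
  "mult_surjective a \<Delta> j \<longleftrightarrow>
     (\<forall>g. \<exists>f. \<forall>T\<in>\<Delta>. card T = Suc j \<longrightarrow> (\<Sum>v\<in>T. a v * f (T - {v})) = g T)"

definition simplicial_complex :: "'v set set \<Rightarrow> bool" where
  "simplicial_complex \<Delta> \<longleftrightarrow> finite (\<Union>\<Delta>) \<and> (\<forall>S\<in>\<Delta>. \<forall>T. T \<subseteq> S \<longrightarrow> T \<in> \<Delta>)"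

lemma simplicial_complexD:
  assumes "simplicial_complex \<Delta>"
  shows "finite \<Delta>" "S \<in> \<Delta> \<Longrightarrow> finite S" "S \<in> \<Delta> \<Longrightarrow> T \<subseteq> S \<Longrightarrow> T \<in> \<Delta>" "finite (link_vertices \<Delta> R)"
proof -
  have fin: "finite (\<Union>\<Delta>)" using assms by (simp add: simplicial_complex_def)
  then show "finite \<Delta>" by (rule finite_UnionD)
  show "S \<in> \<Delta> \<Longrightarrow> finite S" using fin by (meson Union_upper finite_subset)
  show "S \<in> \<Delta> \<Longrightarrow> T \<subseteq> S \<Longrightarrow> T \<in> \<Delta>" using assms by (auto simp: simplicial_complex_def)
  show "finite (link_vertices \<Delta> R)" by (rule finite_subset[OF _ fin]) (auto simp: link_vertices_def)
qed

text \<open>The Fredholm alternative for a matrix with finite index sets. It is proved by adding columns one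
  at a time: if \<open>y\<close> obstructs the solution without the new column, that column is either useless or
  can be used to move the right-hand side into the kernel of \<open>y\<close>.\<close>

lemma linear_system_alternative:
  fixes M :: "'r \<Rightarrow> 'c \<Rightarrow> 'k::field"
  assumes "finite C" "finite R"
  shows "(\<exists>x. \<forall>r\<in>R. (\<Sum>c\<in>C. M r c * x c) = b r) \<or>
         (\<exists>y. (\<forall>c\<in>C. (\<Sum>r\<in>R. y r * M r c) = 0) \<and> (\<Sum>r\<in>R. y r * b r) \<noteq> 0)"
  using \<open>finite C\<close>
proof (induction C arbitrary: b)
  case empty
  show ?case
  proof (cases "\<forall>r\<in>R. b r = 0")
    case False
    then obtain r where r: "r \<in> R" "b r \<noteq> 0" by blast
    have "(\<Sum>s\<in>R. (if s = r then 1 else 0) * b s) = b r"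
      using r \<open>finite R\<close> by (simp add: if_distrib[of "\<lambda>x. x * _"] cong: if_cong)
    then show ?thesis using r by (intro disjI2 exI[of _ "\<lambda>s. if s = r then 1 else 0"]) simp
  qed simp
next
  case (insert c C)
  show ?case
  proof (cases "\<exists>x. \<forall>r\<in>R. (\<Sum>c\<in>C. M r c * x c) = b r")
    case True
    then obtain x where x: "\<And>r. r \<in> R \<Longrightarrow> (\<Sum>c\<in>C. M r c * x c) = b r" by blast
    have "(\<Sum>d\<in>insert c C. M r d * (x(c := 0)) d) = b r" if "r \<in> R" for r
    proof -
      have "(\<Sum>d\<in>C. M r d * (x(c := 0)) d) = (\<Sum>d\<in>C. M r d * x d)"
        using insert.hyps by (intro sum.cong) auto
      then show ?thesis using insert.hyps x[OF that] by simp
    qed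
    then show ?thesis by blast
  next
    case False
    then obtain y where y: "\<And>d. d \<in> C \<Longrightarrow> (\<Sum>r\<in>R. y r * M r d) = 0" "(\<Sum>r\<in>R. y r * b r) \<noteq> 0"
      using insert.IH by blast
    define yc where "yc = (\<Sum>r\<in>R. y r * M r c)"
    define yb where "yb = (\<Sum>r\<in>R. y r * b r)"
    show ?thesis
    proof (cases "yc = 0")
      case True
      then show ?thesis using y insert.hyps by (intro disjI2 exI[of _ y]) (auto simp: yc_def)
    next
      case yc: False
      define b' where "b' = (\<lambda>r. b r - yb / yc * M r c)"
      consider x where "\<And>r. r \<in> R \<Longrightarrow> (\<Sum>d\<in>C. M r d * x d) = b' r"
        | z where "\<And>d. d \<in> C \<Longrightarrow> (\<Sum>r\<in>R. z r * M r d) = 0" "(\<Sum>r\<in>R. z r * b' r) \<noteq> 0"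
        using insert.IH[of b'] by blast
      then show ?thesis
      proof cases
        case 1
        have "(\<Sum>d\<in>insert c C. M r d * (x(c := yb / yc)) d) = b r" if "r \<in> R" for r
        proof -
          have "(\<Sum>d\<in>C. M r d * (x(c := yb / yc)) d) = (\<Sum>d\<in>C. M r d * x d)"
            using insert.hyps by (intro sum.cong) auto
          then show ?thesis using insert.hyps 1[OF that] by (simp add: b'_def)
        qed
        then show ?thesis by blast
      next
        case 2
        define zc where "zc = (\<Sum>r\<in>R. z r * M r c)"
        \<comment> \<open>Correcting \<open>z\<close> by a multiple of \<open>y\<close> makes it orthogonal to the new column as well.\<close>
        define w where "w = (\<lambda>r. z r - zc / yc * y r)"
        have w: "(\<Sum>r\<in>R. w r * h r) = (\<Sum>r\<in>R. z r * h r) - zc / yc * (\<Sum>r\<in>R. y r * h r)" for h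
          by (simp add: w_def left_diff_distrib sum_subtractf sum_distrib_left mult.assoc)
        have "(\<Sum>r\<in>R. z r * b' r) = (\<Sum>r\<in>R. z r * b r) - yb / yc * zc"
          by (simp add: b'_def zc_def right_diff_distrib sum_subtractf sum_distrib_left mult.left_commute)
        then have "(\<Sum>r\<in>R. w r * b r) \<noteq> 0"
          using 2(2) unfolding w yb_def[symmetric] by (simp add: mult.commute)
        moreover have "(\<Sum>r\<in>R. w r * M r d) = 0" if "d \<in> insert c C" for d
          using that 2(1) y(1) yc by (auto simp: w simp flip: yc_def zc_def)
        ultimately show ?thesis by blast
      qed
    qed
  qed
qed

text \<open>The two maps are transposes of each other: both sides run over the pairs of a face \<open>R\<close> of size \<open>j\<close>
  and a vertex \<open>v\<close> that extends it to a face \<open>T\<close>.\<close>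

lemma sum_up_eq_sum_down:
  fixes a :: "'v \<Rightarrow> 'k::field"
  assumes \<Delta>: "simplicial_complex \<Delta>"
  shows "(\<Sum>T\<in>{T\<in>\<Delta>. card T = Suc j}. y T * (\<Sum>v\<in>T. a v * f (T - {v}))) =
         (\<Sum>R\<in>{R\<in>\<Delta>. card R = j}. (\<Sum>v\<in>link_vertices \<Delta> R. a v * y (insert v R)) * f R)"
proof -
  note fin = simplicial_complexD[OF \<Delta>]
  have "(\<Sum>T\<in>{T\<in>\<Delta>. card T = Suc j}. y T * (\<Sum>v\<in>T. a v * f (T - {v}))) =
        (\<Sum>(T, v)\<in>(SIGMA T:{T\<in>\<Delta>. card T = Suc j}. T). y T * (a v * f (T - {v})))"
    using fin by (subst sum.Sigma[symmetric]) (auto simp: sum_distrib_left)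
  also have "\<dots> = (\<Sum>(R, v)\<in>(SIGMA R:{R\<in>\<Delta>. card R = j}. link_vertices \<Delta> R). a v * y (insert v R) * f R)"
    by (rule sum.reindex_bij_witness[where i = "\<lambda>(R, v). (insert v R, v)" and j = "\<lambda>(T, v). (T - {v}, v)"])
       (auto simp: link_vertices_def insert_absorb fin card_Diff_singleton_if)
  also have "\<dots> = (\<Sum>R\<in>{R\<in>\<Delta>. card R = j}. (\<Sum>v\<in>link_vertices \<Delta> R. a v * y (insert v R)) * f R)"
    using fin by (subst sum.Sigma[symmetric]) (auto simp: sum_distrib_right)
  finally show ?thesis .
qed

lemma mult_surjective_iff_coker_trivial:
  fixes a :: "'v \<Rightarrow> 'k::field"
  assumes \<Delta>: "simplicial_complex \<Delta>"
  shows "mult_surjective a \<Delta> j \<longleftrightarrow> coker_trivial a \<Delta> j"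
proof
  note fin = simplicial_complexD[OF \<Delta>]
  assume surj: "mult_surjective a \<Delta> j"
  show "coker_trivial a \<Delta> j"
    unfolding coker_trivial_def
  proof (intro allI impI ballI)
    fix \<phi> :: "'v set \<Rightarrow> 'k" and S
    assume \<phi>: "\<forall>R\<in>\<Delta>. card R = j \<longrightarrow> (\<Sum>v\<in>link_vertices \<Delta> R. a v * \<phi> (insert v R)) = 0"
      and S: "S \<in> \<Delta>" "card S = Suc j"
    obtain f where f: "\<And>T. T \<in> \<Delta> \<Longrightarrow> card T = Suc j \<Longrightarrow>
        (\<Sum>v\<in>T. a v * f (T - {v})) = (if T = S then 1 else 0)"
      using surj[unfolded mult_surjective_def, rule_format, of "\<lambda>T. if T = S then 1 else 0"] by blast
    have "\<phi> S = (\<Sum>T\<in>{T\<in>\<Delta>. card T = Suc j}. if T = S then \<phi> T else 0)"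
      using S fin by simp
    also have "\<dots> = (\<Sum>T\<in>{T\<in>\<Delta>. card T = Suc j}. \<phi> T * (\<Sum>v\<in>T. a v * f (T - {v})))"
      by (rule sum.cong) (auto simp: f)
    also have "\<dots> = 0"
      unfolding sum_up_eq_sum_down[OF \<Delta>] using \<phi> by (intro sum.neutral) auto
    finally show "\<phi> S = 0" .
  qed
next
  note fin = simplicial_complexD[OF \<Delta>]
  assume coker: "coker_trivial a \<Delta> j"
  show "mult_surjective a \<Delta> j"
    unfolding mult_surjective_def
  proof
    fix g :: "'v set \<Rightarrow> 'k"
    define rows where "rows = {T\<in>\<Delta>. card T = Suc j}"
    define cols where "cols = {R\<in>\<Delta>. card R = j}"
    define M where "M = (\<lambda>T R. \<Sum>v\<in>T. a v * (if R = T - {v} then 1 else 0))"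
    have finrc: "finite rows" "finite cols" using fin by (auto simp: rows_def cols_def)
    have M_row: "(\<Sum>R\<in>cols. M T R * x R) = (\<Sum>v\<in>T. a v * x (T - {v}))" if "T \<in> rows" for T x
    proof -
      have "(\<Sum>R\<in>cols. M T R * x R) = (\<Sum>v\<in>T. \<Sum>R\<in>cols. if R = T - {v} then a v * x R else 0)"
        unfolding M_def sum_distrib_right by (subst sum.swap) (auto intro!: sum.cong)
      also have "\<dots> = (\<Sum>v\<in>T. a v * x (T - {v}))"
      proof (rule sum.cong)
        fix v assume "v \<in> T"
        with that have "T - {v} \<in> cols" using fin by (auto simp: rows_def cols_def)
        then show "(\<Sum>R\<in>cols. if R = T - {v} then a v * x R else 0) = a v * x (T - {v})"
          using finrc by simp
      qed simp
      finally show ?thesis .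
    qed
    have no_dual: "(\<Sum>T\<in>rows. y T * g T) = 0" if y: "\<And>R. R \<in> cols \<Longrightarrow> (\<Sum>T\<in>rows. y T * M T R) = 0" for y
    proof -
      have "(\<Sum>v\<in>link_vertices \<Delta> R. a v * y (insert v R)) = 0" if R: "R \<in> \<Delta>" "card R = j" for R
      proof -
        have "(\<Sum>T\<in>rows. y T * M T R) =
          (\<Sum>R'\<in>cols. (\<Sum>v\<in>link_vertices \<Delta> R'. a v * y (insert v R')) * (if R = R' then 1 else 0))"
          unfolding M_def rows_def cols_def by (rule sum_up_eq_sum_down[OF \<Delta>])
        also have "\<dots> = (\<Sum>v\<in>link_vertices \<Delta> R. a v * y (insert v R))"
          using R finrc by (simp add: if_distrib[of "\<lambda>x. _ * x"] cols_def cong: if_cong)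
        finally show ?thesis using y R by (simp add: cols_def)
      qed
      then have "y T = 0" if "T \<in> rows" for T
        using coker that unfolding coker_trivial_def rows_def by blast
      then show ?thesis by simp
    qed
    obtain x where "\<forall>T\<in>rows. (\<Sum>R\<in>cols. M T R * x R) = g T"
      using linear_system_alternative[OF finrc(2,1), of M g] no_dual by blast
    then show "\<exists>f. \<forall>T\<in>\<Delta>. card T = Suc j \<longrightarrow> (\<Sum>v\<in>T. a v * f (T - {v})) = g T"
      using M_row by (intro exI[of _ x]) (auto simp: rows_def)
  qed
qed

section \<open>Reduction to the sum of the variables\<close>

text \<open>If no \<open>a\<^sub>v\<close> vanishes, the substitution \<open>x\<^sub>v \<mapsto> a\<^sub>v x\<^sub>v\<close> turns kernel vectors of the sum of the
  variables into kernel vectors of \<open>\<Sum> a\<^sub>v x\<^sub>v\<close>. In general, replace each vanishing \<open>a\<^sub>v\<close> by a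
  parameter \<open>t\<close> and take the lowest term in \<open>t\<close> of the substituted kernel vector: it consists of
  the faces that meet the zero set \<open>Z\<close> of \<open>a\<close> in the least number of vertices.\<close>

lemma ker_trivial_imp_all_ones:
  fixes a :: "'v \<Rightarrow> 'k::field"
  assumes \<Delta>: "simplicial_complex \<Delta>" and ker: "ker_trivial a \<Delta> j"
  shows "ker_trivial (\<lambda>_. 1 :: 'k) \<Delta> j"
  unfolding ker_trivial_def
proof (intro allI impI)
  note fin = simplicial_complexD[OF \<Delta>]
  fix f :: "'v set \<Rightarrow> 'k"
  assume f: "\<forall>T\<in>\<Delta>. card T = Suc j \<longrightarrow> (\<Sum>v\<in>T. 1 * f (T - {v})) = 0"
  define Z where "Z = {v. a v = 0}"
  show "\<forall>S\<in>\<Delta>. card S = j \<longrightarrow> f S = 0"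
  proof (rule ccontr)
    assume "\<not> ?thesis"
    then obtain S1 where "S1 \<in> \<Delta> \<and> card S1 = j \<and> f S1 \<noteq> 0" by blast
    from ex_has_least_nat[of "\<lambda>S. S \<in> \<Delta> \<and> card S = j \<and> f S \<noteq> 0", OF this,
        of "\<lambda>S. card (S \<inter> Z)"]
    obtain S0 where S0: "S0 \<in> \<Delta>" "card S0 = j" "f S0 \<noteq> 0"
      and least: "\<And>S. S \<in> \<Delta> \<Longrightarrow> card S = j \<Longrightarrow> f S \<noteq> 0 \<Longrightarrow> card (S0 \<inter> Z) \<le> card (S \<inter> Z)"
      by blast
    define g where "g = (\<lambda>S. if card (S \<inter> Z) = card (S0 \<inter> Z) then f S * (\<Prod>v\<in>S - Z. a v) else 0)"
    have "(\<Sum>v\<in>T. a v * g (T - {v})) = 0" if T: "T \<in> \<Delta>" "card T = Suc j" for T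
    proof -
      have "(\<Sum>v\<in>T. a v * g (T - {v})) = (\<Sum>v\<in>T - Z. a v * g (T - {v}))"
        using fin(2)[OF T(1)] by (intro sum.mono_neutral_right) (auto simp: Z_def)
      also have "\<dots> = 0"
      proof (cases "card (T \<inter> Z) = card (S0 \<inter> Z)")
        case False
        have "(T - {v}) \<inter> Z = T \<inter> Z" if "v \<in> T - Z" for v using that by auto
        then show ?thesis using False by (intro sum.neutral) (auto simp: g_def)
      next
        case True
        have "a v * g (T - {v}) = (\<Prod>v\<in>T - Z. a v) * f (T - {v})" if "v \<in> T - Z" for v
        proof -
          have "(T - {v}) \<inter> Z = T \<inter> Z" "(T - {v}) - Z = (T - Z) - {v}" using that by auto
          moreover have "a v * (\<Prod>v\<in>(T - Z) - {v}. a v) = (\<Prod>v\<in>T - Z. a v)"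
            using prod.remove[of "T - Z" v a] that fin(2)[OF T(1)] by simp
          ultimately show ?thesis using True by (simp add: g_def mult.left_commute mult.commute)
        qed
        then have "(\<Sum>v\<in>T - Z. a v * g (T - {v})) = (\<Prod>v\<in>T - Z. a v) * (\<Sum>v\<in>T - Z. f (T - {v}))"
          by (simp add: sum_distrib_left)
        also have "(\<Sum>v\<in>T - Z. f (T - {v})) = (\<Sum>v\<in>T. f (T - {v}))"
        proof (rule sum.mono_neutral_left)
          show "\<forall>v\<in>T - (T - Z). f (T - {v}) = 0"
          proof
            fix v assume v: "v \<in> T - (T - Z)"
            have "(T - {v}) \<inter> Z = (T \<inter> Z) - {v}" by auto
            moreover have "card ((T \<inter> Z) - {v}) < card (T \<inter> Z)"
              using v fin(2)[OF T(1)] by (intro card_Diff1_less) auto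
            moreover have "T - {v} \<in> \<Delta>" "card (T - {v}) = j" using v T fin by auto
            ultimately show "f (T - {v}) = 0" using least[of "T - {v}"] True by force
          qed
        qed (use fin(2)[OF T(1)] in auto)
        also have "\<dots> = 0" using f T by simp
        finally show ?thesis by simp
      qed
      finally show ?thesis .
    qed
    then have "g S0 = 0" using ker S0 unfolding ker_trivial_def by blast
    moreover have "(\<Prod>v\<in>S0 - Z. a v) \<noteq> 0" using fin(2)[OF S0(1)] by (auto simp: Z_def)
    ultimately show False using S0(3) by (simp add: g_def)
  qed
qed

text \<open>The transposed kernel transforms by \<open>x\<^sub>v \<mapsto> x\<^sub>v / a\<^sub>v\<close>, so the leading term in the parameter
  now comes from the faces that meet \<open>Z\<close> in the greatest number of vertices.\<close>

lemma coker_trivial_imp_all_ones: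
  fixes a :: "'v \<Rightarrow> 'k::field"
  assumes \<Delta>: "simplicial_complex \<Delta>" and coker: "coker_trivial a \<Delta> j"
  shows "coker_trivial (\<lambda>_. 1 :: 'k) \<Delta> j"
  unfolding coker_trivial_def
proof (intro allI impI)
  note fin = simplicial_complexD[OF \<Delta>]
  fix \<phi> :: "'v set \<Rightarrow> 'k"
  assume \<phi>: "\<forall>R\<in>\<Delta>. card R = j \<longrightarrow> (\<Sum>v\<in>link_vertices \<Delta> R. 1 * \<phi> (insert v R)) = 0"
  define Z where "Z = {v. a v = 0}"
  show "\<forall>S\<in>\<Delta>. card S = Suc j \<longrightarrow> \<phi> S = 0"
  proof (rule ccontr)
    assume "\<not> ?thesis"
    then obtain S1 where S1: "S1 \<in> \<Delta> \<and> card S1 = Suc j \<and> \<phi> S1 \<noteq> 0" by blast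
    have "card (S \<inter> Z) < Suc (Suc j)" if "S \<in> \<Delta> \<and> card S = Suc j \<and> \<phi> S \<noteq> 0" for S
      using that fin(2) card_mono[of S "S \<inter> Z"] by auto
    then obtain S0 where S0: "S0 \<in> \<Delta>" "card S0 = Suc j" "\<phi> S0 \<noteq> 0"
      and greatest: "\<And>S. S \<in> \<Delta> \<Longrightarrow> card S = Suc j \<Longrightarrow> \<phi> S \<noteq> 0 \<Longrightarrow> card (S \<inter> Z) \<le> card (S0 \<inter> Z)"
      using ex_has_greatest_nat[of "\<lambda>S. S \<in> \<Delta> \<and> card S = Suc j \<and> \<phi> S \<noteq> 0", OF S1,
          of "\<lambda>S. card (S \<inter> Z)" "Suc (Suc j)"] by blast
    define g where "g = (\<lambda>S. if card (S \<inter> Z) = card (S0 \<inter> Z) then \<phi> S / (\<Prod>v\<in>S - Z. a v) else 0)"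
    have "(\<Sum>v\<in>link_vertices \<Delta> R. a v * g (insert v R)) = 0" if R: "R \<in> \<Delta>" "card R = j" for R
    proof -
      have "(\<Sum>v\<in>link_vertices \<Delta> R. a v * g (insert v R)) = (\<Sum>v\<in>link_vertices \<Delta> R - Z. a v * g (insert v R))"
        using fin by (intro sum.mono_neutral_right) (auto simp: Z_def)
      also have "\<dots> = 0"
      proof (cases "card (R \<inter> Z) = card (S0 \<inter> Z)")
        case False
        have "insert v R \<inter> Z = R \<inter> Z" if "v \<in> link_vertices \<Delta> R - Z" for v using that by auto
        then show ?thesis using False by (intro sum.neutral) (auto simp: g_def)
      next
        case True
        have "a v * g (insert v R) = \<phi> (insert v R) / (\<Prod>v\<in>R - Z. a v)" if v: "v \<in> link_vertices \<Delta> R - Z" for v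
        proof -
          have "insert v R \<inter> Z = R \<inter> Z" "insert v R - Z = insert v (R - Z)" using v by auto
          moreover have "v \<notin> R - Z" "a v \<noteq> 0" using v by (auto simp: link_vertices_def Z_def)
          ultimately show ?thesis using True fin(2)[OF R(1)] by (simp add: g_def)
        qed
        then have "(\<Sum>v\<in>link_vertices \<Delta> R - Z. a v * g (insert v R)) =
            (\<Sum>v\<in>link_vertices \<Delta> R - Z. \<phi> (insert v R)) / (\<Prod>v\<in>R - Z. a v)"
          by (simp add: sum_divide_distrib)
        also have "(\<Sum>v\<in>link_vertices \<Delta> R - Z. \<phi> (insert v R)) = (\<Sum>v\<in>link_vertices \<Delta> R. \<phi> (insert v R))"
        proof (rule sum.mono_neutral_left)
          show "\<forall>v\<in>link_vertices \<Delta> R - (link_vertices \<Delta> R - Z). \<phi> (insert v R) = 0"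
          proof
            fix v assume "v \<in> link_vertices \<Delta> R - (link_vertices \<Delta> R - Z)"
            then have v: "v \<in> link_vertices \<Delta> R" "v \<in> Z" by auto
            have "insert v R \<inter> Z = insert v (R \<inter> Z)" using v by auto
            moreover have "v \<notin> R" "insert v R \<in> \<Delta>" using v by (auto simp: link_vertices_def)
            ultimately have "card (insert v R \<inter> Z) = Suc (card (S0 \<inter> Z))" "card (insert v R) = Suc j"
              using True R fin(2)[OF R(1)] by auto
            then show "\<phi> (insert v R) = 0" using greatest[OF \<open>insert v R \<in> \<Delta>\<close>] by force
          qed
        qed (use fin in auto)
        also have "\<dots> = 0" using \<phi> R by simp
        finally show ?thesis by simp
      qed
      finally show ?thesis .
    qed
    then have "g S0 = 0" using coker S0 unfolding coker_trivial_def by blast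
    moreover have "(\<Prod>v\<in>S0 - Z. a v) \<noteq> 0" using fin(2)[OF S0(1)] by (auto simp: Z_def)
    ultimately show False using S0(3) by (simp add: g_def)
  qed
qed

lemma coker_trivial_onesD:
  assumes "coker_trivial (\<lambda>_. 1 :: 'k::field) \<Delta> j" "S \<in> \<Delta>" "card S = Suc j"
    and "\<And>R. R \<in> \<Delta> \<Longrightarrow> card R = j \<Longrightarrow> (\<Sum>v\<in>link_vertices \<Delta> R. 1 * \<phi> (insert v R)) = 0"
  shows "\<phi> S = (0 :: 'k)"
proof -
  have "\<forall>R\<in>\<Delta>. card R = j \<longrightarrow> (\<Sum>v\<in>link_vertices \<Delta> R. 1 * \<phi> (insert v R)) = 0"
    using assms(4) by blast
  with assms(1)[unfolded coker_trivial_def, THEN spec[of _ \<phi>]]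
  have "\<forall>S\<in>\<Delta>. card S = Suc j \<longrightarrow> \<phi> S = 0" by (rule mp)
  then show ?thesis using assms(2,3) by blast
qed

section \<open>Non-trivial kernels from cancelling signs\<close>

text \<open>The kernel vector is the product over \<open>i < j\<close> of the sums \<open>\<Sum> s\<^sub>v x\<^sub>v\<close> over the fibres
  \<open>e v = i\<close>. A face with \<open>j + 1\<close> vertices has two vertices \<open>u\<close>, \<open>v\<close> in one fibre by the
  pigeonhole principle, and only the removal of \<open>u\<close> or of \<open>v\<close> can make \<open>e\<close> injective on it.\<close>

lemma not_ker_trivial_if_signs_cancel:
  fixes e :: "'v \<Rightarrow> nat" and s :: "'v \<Rightarrow> 'k::field"
  assumes \<Delta>: "simplicial_complex \<Delta>" and e: "\<And>v. v \<in> \<Union>\<Delta> \<Longrightarrow> e v < j"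
    and cancel: "\<And>T u v. T \<in> \<Delta> \<Longrightarrow> u \<in> T \<Longrightarrow> v \<in> T \<Longrightarrow> u \<noteq> v \<Longrightarrow> e u = e v \<Longrightarrow> s u + s v = 0"
    and S: "S \<in> \<Delta>" "card S = j" "inj_on e S" and s: "\<And>v. v \<in> S \<Longrightarrow> s v \<noteq> 0"
  shows "\<not> ker_trivial (\<lambda>_. 1 :: 'k) \<Delta> j"
proof
  note fin = simplicial_complexD[OF \<Delta>]
  define f where "f = (\<lambda>S. if inj_on e S then \<Prod>v\<in>S. s v else 0)"
  have "(\<Sum>v\<in>T. 1 * f (T - {v})) = 0" if T: "T \<in> \<Delta>" "card T = Suc j" for T
  proof -
    have "card (e ` T) \<le> j" using e T(1) card_mono[of "{..<j}" "e ` T"] by auto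
    then have "\<not> inj_on e T" using T(2) card_image[of e T] by auto
    then obtain u v where uv: "u \<in> T" "v \<in> T" "u \<noteq> v" "e u = e v" by (auto simp: inj_on_def)
    define B where "B = T - {u, v}"
    have B: "T - {u} = insert v B" "T - {v} = insert u B" "u \<notin> B" "v \<notin> B" "finite B"
      using uv fin(2)[OF T(1)] by (auto simp: B_def)
    have "f (T - {w}) = 0" if "w \<in> T - {u, v}" for w
      using that uv by (auto simp: f_def inj_on_def)
    then have "(\<Sum>w\<in>T. 1 * f (T - {w})) = (\<Sum>w\<in>{u, v}. f (T - {w}))"
      using uv fin(2)[OF T(1)] by (intro sum.mono_neutral_cong_right) auto
    also have "\<dots> = f (insert v B) + f (insert u B)" using uv B by simp
    also have "\<dots> = 0"
      using cancel[OF T(1) uv] B uv(4) by (auto simp: f_def add.commute simp flip: distrib_right)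
    finally show ?thesis .
  qed
  moreover assume "ker_trivial (\<lambda>_. 1 :: 'k) \<Delta> j"
  ultimately have "f S = 0" using S unfolding ker_trivial_def by blast
  then show False using S s fin(2)[OF S(1)] by (simp add: f_def)
qed

text \<open>The same product over the fibres in \<open>M\<close>, for the transpose. A face of size \<open>j\<close> on which
  \<open>e\<close> is injective misses exactly one fibre, and the contributions of the vertices of that fibre
  cancel. For two-element fibres this is the obstruction given by an induced matching.\<close>

lemma not_coker_trivial_if_signs_cancel:
  fixes e :: "'v \<Rightarrow> nat" and s :: "'v \<Rightarrow> 'k::field"
  assumes \<Delta>: "simplicial_complex \<Delta>" and M: "finite M" "\<And>v. v \<in> M \<Longrightarrow> e v \<le> j"
    and faces: "\<And>S. S \<subseteq> M \<Longrightarrow> inj_on e S \<Longrightarrow> S \<in> \<Delta>"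
    and cancel: "\<And>i. i \<le> j \<Longrightarrow> (\<Sum>v\<in>{v\<in>M. e v = i}. s v) = 0"
    and S: "S \<subseteq> M" "card S = Suc j" "inj_on e S" and s: "\<And>v. v \<in> S \<Longrightarrow> s v \<noteq> 0"
  shows "\<not> coker_trivial (\<lambda>_. 1 :: 'k) \<Delta> j"
proof
  note fin = simplicial_complexD[OF \<Delta>]
  define \<phi> where "\<phi> = (\<lambda>S. if S \<subseteq> M \<and> inj_on e S then \<Prod>v\<in>S. s v else 0)"
  have "(\<Sum>v\<in>link_vertices \<Delta> R. 1 * \<phi> (insert v R)) = 0" if R: "R \<in> \<Delta>" "card R = j" for R
  proof (cases "R \<subseteq> M \<and> inj_on e R")
    case False
    then show ?thesis by (intro sum.neutral) (auto simp: \<phi>_def inj_on_def)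
  next
    case True
    then have "card ({..j} - e ` R) = 1"
      using M R fin(2)[OF R(1)] by (subst card_Diff_subset) (auto simp: card_image)
    then obtain i where i: "{..j} - e ` R = {i}" by (auto simp: card_1_singleton_iff)
    have \<phi>: "\<phi> (insert v R) = (if v \<in> M \<and> e v = i then s v * (\<Prod>w\<in>R. s w) else 0)"
      if v: "v \<notin> R" for v
    proof -
      have "inj_on e (insert v R) \<longleftrightarrow> e v \<notin> e ` R" using v True by auto
      moreover have "e v \<notin> e ` R \<longleftrightarrow> e v = i" if "v \<in> M" using i M(2)[OF that] by auto
      ultimately show ?thesis using True v fin(2)[OF R(1)] by (auto simp: \<phi>_def)
    qed
    have sub: "{v\<in>M. e v = i} \<subseteq> link_vertices \<Delta> R"
    proof
      fix v assume v: "v \<in> {v\<in>M. e v = i}"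
      then have "v \<notin> R" "inj_on e (insert v R)" using i True by auto
      then show "v \<in> link_vertices \<Delta> R" using faces[of "insert v R"] v True by (auto simp: link_vertices_def)
    qed
    have "(\<Sum>v\<in>link_vertices \<Delta> R. 1 * \<phi> (insert v R)) = (\<Sum>v\<in>{v\<in>M. e v = i}. s v * (\<Prod>w\<in>R. s w))"
      using fin sub by (intro sum.mono_neutral_cong_right) (auto simp: \<phi> link_vertices_def)
    also have "\<dots> = 0" using cancel[of i] i by (auto simp flip: sum_distrib_right)
    finally show ?thesis .
  qed
  moreover assume "coker_trivial (\<lambda>_. 1 :: 'k) \<Delta> j"
  ultimately have "\<phi> S = 0" using S faces[OF S(1,3)] unfolding coker_trivial_def by blast
  then show False using S s finite_subset[OF S(1) M(1)] by (simp add: \<phi>_def)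
qed

section \<open>Simplicial maps\<close>

text \<open>A simplicial map that preserves the sizes of faces; such maps pull back kernels and push
  forward transposed kernels in every degree.\<close>

definition nondegenerate_map :: "('v \<Rightarrow> 'w) \<Rightarrow> 'v set set \<Rightarrow> 'w set set \<Rightarrow> bool" where
  "nondegenerate_map \<pi> \<Delta> \<Delta>' \<longleftrightarrow> (\<forall>S\<in>\<Delta>. inj_on \<pi> S \<and> \<pi> ` S \<in> \<Delta>')"

text \<open>A kernel vector \<open>f\<close> on \<open>\<Delta>'\<close> pulls back to \<open>S \<mapsto> f(\<pi> S)\<close>. Different faces of \<open>\<Delta>'\<close> may be covered
  by different maps, so a complex can be tested on a family of subcomplexes.\<close>

lemma ker_trivial_pullback:
  assumes ker: "ker_trivial (\<lambda>_. 1 :: 'k::field) \<Delta> j"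
    and cover: "\<And>S'. S' \<in> \<Delta>' \<Longrightarrow> \<exists>\<pi> S. nondegenerate_map \<pi> \<Delta> \<Delta>' \<and> S \<in> \<Delta> \<and> \<pi> ` S = S'"
  shows "ker_trivial (\<lambda>_. 1 :: 'k) \<Delta>' j"
  unfolding ker_trivial_def
proof (intro allI impI ballI)
  fix f :: "'b set \<Rightarrow> 'k" and S'
  assume f: "\<forall>T\<in>\<Delta>'. card T = Suc j \<longrightarrow> (\<Sum>v\<in>T. 1 * f (T - {v})) = 0"
    and S': "S' \<in> \<Delta>'" "card S' = j"
  obtain \<pi> S where \<pi>: "nondegenerate_map \<pi> \<Delta> \<Delta>'" and S: "S \<in> \<Delta>" "\<pi> ` S = S'"
    using cover[OF S'(1)] by blast
  have inj: "inj_on \<pi> T" and face: "\<pi> ` T \<in> \<Delta>'" if "T \<in> \<Delta>" for T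
    using \<pi> that by (auto simp: nondegenerate_map_def)
  have "(\<Sum>v\<in>T. 1 * f (\<pi> ` (T - {v}))) = 0" if T: "T \<in> \<Delta>" "card T = Suc j" for T
  proof -
    have "0 = (\<Sum>w\<in>\<pi> ` T. 1 * f (\<pi> ` T - {w}))"
      using f face[OF T(1)] card_image[OF inj[OF T(1)]] T(2) by simp
    also have "\<dots> = (\<Sum>v\<in>T. 1 * f (\<pi> ` T - {\<pi> v}))"
      by (simp add: sum.reindex[OF inj[OF T(1)]])
    also have "\<dots> = (\<Sum>v\<in>T. 1 * f (\<pi> ` (T - {v})))"
      using inj[OF T(1)] by (intro sum.cong) (auto simp: inj_on_image_set_diff[of \<pi> T])
    finally show ?thesis by simp
  qed
  moreover have "card S = j" using card_image[OF inj[OF S(1)]] S(2) S'(2) by simp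
  ultimately have "f (\<pi> ` S) = 0"
    using ker[unfolded ker_trivial_def, rule_format, of "\<lambda>S. f (\<pi> ` S)" S] S(1) by blast
  then show "f S' = 0" using S(2) by simp
qed

text \<open>The push-forward sums over the fibres of \<open>S \<mapsto> \<pi> S\<close>. Extending a face \<open>R'\<close> of \<open>\<Delta>'\<close> by \<open>w\<close> and
  lifting the result to \<open>S\<close> is the same as lifting \<open>R'\<close> to \<open>R\<close> and extending it by \<open>v\<close>, since
  \<open>\<pi>\<close> is injective on \<open>S\<close>.\<close>

lemma coker_pushforward:
  fixes \<phi> :: "'v set \<Rightarrow> 'k::field"
  assumes \<Delta>: "simplicial_complex \<Delta>" and \<Delta>': "simplicial_complex \<Delta>'"
    and \<pi>: "nondegenerate_map \<pi> \<Delta> \<Delta>'"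
    and \<phi>: "\<forall>R\<in>\<Delta>. card R = j \<longrightarrow> (\<Sum>v\<in>link_vertices \<Delta> R. 1 * \<phi> (insert v R)) = 0"
    and R': "R' \<in> \<Delta>'" "card R' = j"
  shows "(\<Sum>w\<in>link_vertices \<Delta>' R'. 1 * (\<Sum>S\<in>{S\<in>\<Delta>. \<pi> ` S = insert w R'}. \<phi> S)) = 0"
proof -
  note fin = simplicial_complexD[OF \<Delta>] simplicial_complexD[OF \<Delta>']
  have inj: "inj_on \<pi> T" and face: "\<pi> ` T \<in> \<Delta>'" if "T \<in> \<Delta>" for T
    using \<pi> that by (auto simp: nondegenerate_map_def)
  define A where "A = (SIGMA R:{R\<in>\<Delta>. \<pi> ` R = R'}. link_vertices \<Delta> R)"
  define B where "B = (SIGMA w:link_vertices \<Delta>' R'. {S\<in>\<Delta>. \<pi> ` S = insert w R'})"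
  define h where "h = (\<lambda>(R, v). (\<pi> v, insert v R))"
  have "bij_betw h A B"
    unfolding bij_betw_def
  proof
    show "inj_on h A"
    proof (rule inj_onI)
      fix x y assume xy: "x \<in> A" "y \<in> A" "h x = h y"
      obtain R v P w where [simp]: "x = (R, v)" "y = (P, w)" by (metis surj_pair)
      have *: "v \<notin> R" "insert v R \<in> \<Delta>" "w \<notin> P" "\<pi> v = \<pi> w" "insert v R = insert w P"
        using xy by (auto simp: A_def h_def link_vertices_def)
      then have "v = w" using inj_onD[OF inj[OF *(2)] *(4)] by auto
      then show "x = y" using * by auto
    qed
    show "h ` A = B"
    proof (intro Set.set_eqI iffI)
      fix y assume "y \<in> h ` A"
      then obtain R v where y: "y = (\<pi> v, insert v R)" and R: "R \<in> \<Delta>" "\<pi> ` R = R'" "v \<notin> R" "insert v R \<in> \<Delta>"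
        by (auto simp: A_def h_def link_vertices_def)
      have "\<pi> v \<notin> \<pi> ` R" using inj[OF R(4)] R(3) by auto
      then show "y \<in> B" using R face[OF R(4)] by (auto simp: B_def y link_vertices_def)
    next
      fix y assume "y \<in> B"
      then obtain w S where y: "y = (w, S)" and w: "w \<notin> R'" and S: "S \<in> \<Delta>" "\<pi> ` S = insert w R'"
        by (auto simp: B_def link_vertices_def)
      then obtain v where v: "v \<in> S" "\<pi> v = w" by (metis imageE insertI1)
      have "\<pi> ` (S - {v}) = R'"
        using inj_on_image_set_diff[OF inj[OF S(1)], of S "{v}"] v S(2) w by auto
      moreover have "S - {v} \<in> \<Delta>" using fin(3)[OF S(1)] by auto
      ultimately have "(S - {v}, v) \<in> A" using S(1) v by (auto simp: A_def link_vertices_def insert_absorb)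
      then show "y \<in> h ` A" using v by (force simp: y h_def insert_absorb)
    qed
  qed
  then have "(\<Sum>(w, S)\<in>B. \<phi> S) = (\<Sum>(R, v)\<in>A. \<phi> (insert v R))"
    by (subst sum.reindex_bij_betw[symmetric]) (auto simp: h_def case_prod_unfold)
  moreover have "(\<Sum>(w, S)\<in>B. \<phi> S) = (\<Sum>w\<in>link_vertices \<Delta>' R'. 1 * (\<Sum>S\<in>{S\<in>\<Delta>. \<pi> ` S = insert w R'}. \<phi> S))"
    unfolding B_def using fin by (subst sum.Sigma[symmetric]) auto
  moreover have "(\<Sum>(R, v)\<in>A. \<phi> (insert v R)) = (\<Sum>R\<in>{R\<in>\<Delta>. \<pi> ` R = R'}. \<Sum>v\<in>link_vertices \<Delta> R. 1 * \<phi> (insert v R))"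
    unfolding A_def using fin by (subst sum.Sigma[symmetric]) auto
  moreover have "\<dots> = 0"
    using \<phi> R' card_image[OF inj] by (intro sum.neutral) auto
  ultimately show ?thesis by simp
qed

lemma coker_trivial_pushforward:
  assumes \<Delta>: "simplicial_complex \<Delta>" and \<Delta>': "simplicial_complex \<Delta>'"
    and \<pi>: "nondegenerate_map \<pi> \<Delta> \<Delta>'" and inj: "inj_on \<pi> (\<Union>\<Delta>)"
    and coker: "coker_trivial (\<lambda>_. 1 :: 'k::field) \<Delta>' j"
  shows "coker_trivial (\<lambda>_. 1 :: 'k) \<Delta> j"
  unfolding coker_trivial_def
proof (intro allI impI ballI)
  fix \<phi> :: "'a set \<Rightarrow> 'k" and S
  assume \<phi>: "\<forall>R\<in>\<Delta>. card R = j \<longrightarrow> (\<Sum>v\<in>link_vertices \<Delta> R. 1 * \<phi> (insert v R)) = 0"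
    and S: "S \<in> \<Delta>" "card S = Suc j"
  have "card (\<pi> ` S) = Suc j" "\<pi> ` S \<in> \<Delta>'"
    using \<pi> S by (auto simp: nondegenerate_map_def card_image)
  then have "(\<Sum>T\<in>{T\<in>\<Delta>. \<pi> ` T = \<pi> ` S}. \<phi> T) = 0"
    using coker[unfolded coker_trivial_def, rule_format, of "\<lambda>S'. \<Sum>T\<in>{T\<in>\<Delta>. \<pi> ` T = S'}. \<phi> T" "\<pi> ` S"]
      coker_pushforward[OF \<Delta> \<Delta>' \<pi> \<phi>] by simp
  moreover have "T = S" if "T \<in> \<Delta>" "\<pi> ` T = \<pi> ` S" for T
    using inj_on_image_eq_iff[OF inj, of T S] that S(1) by (simp add: Union_upper)
  then have "{T\<in>\<Delta>. \<pi> ` T = \<pi> ` S} = {S}" using S(1) by auto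
  ultimately show "\<phi> S = 0" by simp
qed

section \<open>Powers of the sum of the variables on a path\<close>

definition path_faces :: "nat \<Rightarrow> nat set set" where
  "path_faces N = {S. S \<subseteq> {1..N} \<and> (\<forall>v\<in>S. Suc v \<notin> S)}"

lemma simplicial_complex_path_faces: "simplicial_complex (path_faces N)"
proof -
  have "\<Union>(path_faces N) \<subseteq> {1..N}" by (auto simp: path_faces_def)
  then have "finite (\<Union>(path_faces N))" by (rule finite_subset) simp
  moreover have "\<forall>S\<in>path_faces N. \<forall>T. T \<subseteq> S \<longrightarrow> T \<in> path_faces N"
    unfolding path_faces_def by blast
  ultimately show ?thesis by (simp add: simplicial_complex_def)
qed

lemmas path_faces = simplicial_complexD[OF simplicial_complex_path_faces]

lemma path_faces_mono: "N \<le> N' \<Longrightarrow> S \<in> path_faces N \<Longrightarrow> S \<in> path_faces N'"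
  by (auto simp: path_faces_def)

lemma path_faces_insert_last:
  "1 \<le> N \<Longrightarrow> S \<in> path_faces (N - 2) \<Longrightarrow> insert N S \<in> path_faces N \<and> N \<notin> S"
  unfolding path_faces_def
proof (intro conjI CollectI)
  assume N: "1 \<le> N" and S: "S \<in> {S. S \<subseteq> {1..N - 2} \<and> (\<forall>v\<in>S. Suc v \<notin> S)}"
  have le: "v \<le> N - 2" "1 \<le> v" if "v \<in> S" for v using S that by auto
  show "insert N S \<subseteq> {1..N}" using N le by fastforce
  show "\<forall>v\<in>insert N S. Suc v \<notin> insert N S" using N S le by fastforce
  show "N \<notin> S" using N le by fastforce
qed

lemma path_faces_cases:
  assumes "S \<in> path_faces N" "1 \<le> N"
  obtains (without) "S \<in> path_faces (N - 1)"
    | (with_last) S' where "S = insert N S'" "N \<notin> S'" "S' \<in> path_faces (N - 2)"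
proof (cases "N \<in> S")
  case False
  have "v \<le> N - 1" if "v \<in> S" for v
  proof -
    have "v \<le> N" "v \<noteq> N" using assms that False by (auto simp: path_faces_def)
    then show ?thesis by simp
  qed
  then have "S \<in> path_faces (N - 1)" using assms by (auto simp: path_faces_def)
  then show thesis by (rule without)
next
  case True
  have "v \<le> N - 2" if "v \<in> S - {N}" for v
  proof -
    have "v \<le> N" "v \<noteq> N" "Suc v \<noteq> N" using assms that True by (auto simp: path_faces_def)
    then show ?thesis by simp
  qed
  moreover have "1 \<le> v" if "v \<in> S" for v using assms that by (auto simp: path_faces_def)
  moreover have "\<forall>v\<in>S. Suc v \<notin> S" using assms by (simp add: path_faces_def)
  ultimately have "S - {N} \<in> path_faces (N - 2)" unfolding path_faces_def by fastforce
  then show thesis using True by (intro with_last[of "S - {N}"]) auto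
qed

lemma card_path_face: "S \<in> path_faces N \<Longrightarrow> 2 * card S \<le> N + 1"
proof (induction N arbitrary: S rule: less_induct)
  case (less N)
  show ?case
  proof (cases "N = 0")
    case True
    then show ?thesis using less.prems by (simp add: path_faces_def)
  next
    case False
    then have "1 \<le> N" by simp
    with less.prems show ?thesis
    proof (cases rule: path_faces_cases)
      case without
      then show ?thesis using less.IH[of "N - 1" S] False by simp
    next
      case (with_last S')
      show ?thesis
      proof (cases "N = 1")
        case True
        then show ?thesis using with_last by (auto simp: path_faces_def)
      next
        case False
        then show ?thesis using with_last less.IH[of "N - 2" S'] \<open>1 \<le> N\<close>
          by (auto simp: card_insert_if path_faces(2))
      qed
    qed
  qed
qed

lemma sum_subsets_insert:
  assumes "finite T" "x \<notin> T"
  shows "(\<Sum>S\<in>{S. S \<subseteq> insert x T \<and> card S = j}. f S) =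
         (\<Sum>S\<in>{S. S \<subseteq> T \<and> card S = j}. f S) +
         (\<Sum>S\<in>{S. S \<subseteq> T \<and> Suc (card S) = j}. f (insert x S))"
proof -
  have eq: "{S. S \<subseteq> insert x T \<and> card S = j} =
      {S. S \<subseteq> T \<and> card S = j} \<union> insert x ` {S. S \<subseteq> T \<and> Suc (card S) = j}"
  proof (intro Set.set_eqI iffI)
    fix S assume S: "S \<in> {S. S \<subseteq> insert x T \<and> card S = j}"
    show "S \<in> {S. S \<subseteq> T \<and> card S = j} \<union> insert x ` {S. S \<subseteq> T \<and> Suc (card S) = j}"
    proof (cases "x \<in> S")
      case True
      have "finite S" using S assms finite_subset[of S "insert x T"] by auto
      then have "S = insert x (S - {x})" "S - {x} \<subseteq> T" "Suc (card (S - {x})) = j"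
        using S True card_Suc_Diff1[of S x] by auto
      then show ?thesis by blast
    qed (use S in auto)
  next
    fix S assume "S \<in> {S. S \<subseteq> T \<and> card S = j} \<union> insert x ` {S. S \<subseteq> T \<and> Suc (card S) = j}"
    then show "S \<in> {S. S \<subseteq> insert x T \<and> card S = j}"
      using assms finite_subset[of _ T] by (auto simp: card_insert_if)
  qed
  have inj: "inj_on (insert x) {S. S \<subseteq> T \<and> Suc (card S) = j}"
    using assms(2) by (auto simp: inj_on_def)
  have fin: "finite {S. S \<subseteq> T \<and> card S = j}" "finite {S. S \<subseteq> T \<and> Suc (card S) = j}"
    using assms(1) by (auto intro: finite_subset[of _ "Pow T"])
  show ?thesis
    unfolding eq using assms(2) fin
    by (subst sum.union_disjoint) (auto simp: sum.reindex[OF inj])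
qed

text \<open>This is \<open>\<ell> \<cdot> \<ell>\<^sup>r = \<ell>\<^bsup>r+1\<^esup>\<close> in divided powers: the sum over all subsets of size \<open>j\<close> of \<open>T\<close> is
  the coefficient at \<open>T\<close> of the divided power of \<open>\<ell>\<close> with exponent \<open>card T - j\<close>.\<close>

lemma sum_subsets_of_facets:
  fixes f :: "'v set \<Rightarrow> 'k::comm_ring_1"
  assumes T: "finite T"
  shows "(\<Sum>v\<in>T. \<Sum>S\<in>{S. S \<subseteq> T - {v} \<and> card S = j}. f S) =
         of_nat (card T - j) * (\<Sum>S\<in>{S. S \<subseteq> T \<and> card S = j}. f S)"
proof -
  have "(\<Sum>v\<in>T. \<Sum>S\<in>{S. S \<subseteq> T - {v} \<and> card S = j}. f S) =
        (\<Sum>v\<in>T. \<Sum>S\<in>{S\<in>{S. S \<subseteq> T \<and> card S = j}. v \<notin> S}. f S)"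
    by (intro sum.cong) auto
  also have "\<dots> = (\<Sum>S\<in>{S. S \<subseteq> T \<and> card S = j}. \<Sum>v\<in>{v\<in>T. v \<notin> S}. f S)"
    using T by (intro sum.swap_restrict) auto
  also have "\<dots> = (\<Sum>S\<in>{S. S \<subseteq> T \<and> card S = j}. of_nat (card T - j) * f S)"
  proof (rule sum.cong)
    fix S assume S: "S \<in> {S. S \<subseteq> T \<and> card S = j}"
    have "{v\<in>T. v \<notin> S} = T - S" by auto
    then have "card {v\<in>T. v \<notin> S} = card T - j"
      using S card_Diff_subset[of S T] finite_subset[of S T] T by auto
    then show "(\<Sum>v\<in>{v\<in>T. v \<notin> S}. f S) = of_nat (card T - j) * f S" by simp
  qed simp
  finally show ?thesis by (simp add: sum_distrib_left)
qed

text \<open>The hypothesis on \<open>f\<close> says \<open>\<ell>\<^sup>r f = 0\<close>. Write \<open>f = g + x\<^sub>N h\<close>, where \<open>g\<close> does not involve \<open>x\<^sub>N\<close>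
  and \<open>h\<close> lives on the path with \<open>N - 2\<close> vertices. Comparing the terms with \<open>x\<^sub>N\<close> gives
  \<open>\<ell>\<^sup>r h + r \<ell>\<^bsup>r-1\<^esup> g = 0\<close> on that path, where also \<open>\<ell>\<^sup>r g = 0\<close>, hence \<open>\<ell>\<^bsup>r+1\<^esup> h = 0\<close>.
  As \<open>h\<close> has degree \<open>j - 1\<close>, the induction hypothesis gives \<open>h = 0\<close>, because two vertices fewer are
  just enough for one degree less and one power more. Then \<open>\<ell>\<^bsup>r-1\<^esup> g = 0\<close> on \<open>N - 2\<close>
  vertices, so \<open>g\<close> vanishes there. What is left of \<open>f\<close> is a multiple of \<open>x\<^bsub>N-1\<^esub>\<close>, whose
  cofactor lives on \<open>N - 3\<close> vertices in degree \<open>j - 1\<close> and is killed by \<open>\<ell>\<^sup>r\<close>.\<close>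

lemma path_power_injective:
  fixes f :: "nat set \<Rightarrow> 'k::field_char_0"
  assumes "4 * j + 2 * r \<le> N + 1"
    and "\<And>T. T \<in> path_faces N \<Longrightarrow> card T = j + r \<Longrightarrow> (\<Sum>S\<in>{S. S \<subseteq> T \<and> card S = j}. f S) = 0"
    and "S \<in> path_faces N" "card S = j"
  shows "f S = 0"
  using assms
proof (induction N arbitrary: j r f S rule: less_induct)
  case (less N)
  note bound = less.prems(1) and eqs = less.prems(2)
  show ?case
  proof (cases "r = 0")
    case True
    have "{S'. S' \<subseteq> S \<and> card S' = j} = {S}"
      using less.prems(4) path_faces(2)[OF less.prems(3)] by (auto dest: card_subset_eq)
    then show ?thesis using eqs[OF less.prems(3)] less.prems(4) True by simp
  next
    case False
    then have N: "1 \<le> N" using bound by simp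
    \<comment> \<open>The terms with \<open>x\<^sub>N\<close>; for \<open>N = 1\<close> the truncated \<open>N - 2\<close> correctly gives the empty path.\<close>
    have last_eq: "(\<Sum>S\<in>{S. S \<subseteq> T \<and> card S = j}. f S) +
        (\<Sum>S\<in>{S. S \<subseteq> T \<and> Suc (card S) = j}. f (insert N S)) = 0"
      if T: "T \<in> path_faces (N - 2)" "Suc (card T) = j + r" for T
    proof -
      note ins = path_faces_insert_last[OF N T(1)]
      have "card (insert N T) = j + r" using ins T path_faces(2)[OF T(1)] by simp
      then show ?thesis
        using eqs[of "insert N T"] ins sum_subsets_insert[of T N f j] path_faces(2)[OF T(1)] by simp
    qed
    have last_zero: "f (insert N S') = 0" if S': "S' \<in> path_faces (N - 2)" "Suc (card S') = j" for S'
    proof -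
      obtain i where i: "j = Suc i" using S'(2) by (cases j) auto
      have N': "N - 2 < N" "4 * i + 2 * Suc r \<le> N - 2 + 1" using bound i N by auto
      show ?thesis
      proof (rule less.IH[OF N', where f = "\<lambda>S. f (insert N S)" and S = S'])
        fix T assume T: "T \<in> path_faces (N - 2)" "card T = i + Suc r"
        have Tfin: "finite T" by (rule path_faces(2)[OF T(1)])
        have T_N: "T \<in> path_faces N" using path_faces_mono[OF _ T(1), of N] by simp
        \<comment> \<open>Multiply the equation for the terms with \<open>x\<^sub>N\<close> by \<open>\<ell>\<close>; the part with \<open>g\<close> drops out.\<close>
        have "0 = (\<Sum>v\<in>T. (\<Sum>S\<in>{S. S \<subseteq> T - {v} \<and> card S = j}. f S) +
            (\<Sum>S\<in>{S. S \<subseteq> T - {v} \<and> card S = i}. f (insert N S)))"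
        proof (rule sum.neutral[symmetric], rule ballI)
          fix v assume "v \<in> T"
          then have "T - {v} \<in> path_faces (N - 2)" "Suc (card (T - {v})) = j + r"
            using T i path_faces(3)[OF T(1)] Tfin by auto
          from last_eq[OF this] show "(\<Sum>S\<in>{S. S \<subseteq> T - {v} \<and> card S = j}. f S) +
            (\<Sum>S\<in>{S. S \<subseteq> T - {v} \<and> card S = i}. f (insert N S)) = 0" by (simp add: i)
        qed
        also have "\<dots> = of_nat r * (\<Sum>S\<in>{S. S \<subseteq> T \<and> card S = j}. f S) +
            of_nat (Suc r) * (\<Sum>S\<in>{S. S \<subseteq> T \<and> card S = i}. f (insert N S))"
          unfolding sum.distrib sum_subsets_of_facets[OF Tfin] using T(2) i by simp
        also have "(\<Sum>S\<in>{S. S \<subseteq> T \<and> card S = j}. f S) = 0"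
          using eqs[OF T_N] T(2) i by simp
        finally show "(\<Sum>S\<in>{S. S \<subseteq> T \<and> card S = i}. f (insert N S)) = 0"
          by (simp del: of_nat_Suc)
      qed (use S' i in auto)
    qed
    have low: "f S' = 0" if S': "S' \<in> path_faces (N - 2)" "card S' = j" for S'
    proof (rule less.IH[of "N - 2" j "r - 1" f S'])
      fix T assume T: "T \<in> path_faces (N - 2)" "card T = j + (r - 1)"
      have "(\<Sum>S\<in>{S. S \<subseteq> T \<and> Suc (card S) = j}. f (insert N S)) = 0"
        using last_zero path_faces(3)[OF T(1)] by (intro sum.neutral) auto
      then show "(\<Sum>S\<in>{S. S \<subseteq> T \<and> card S = j}. f S) = 0"
        using last_eq[OF T(1)] T(2) False by simp
    qed (use S' bound False N in auto)
    have before_last: "f (insert (N - 1) S') = 0"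
      if S': "S' \<in> path_faces (N - 1 - 2)" "Suc (card S') = j" and N2: "2 \<le> N" for S'
    proof -
      obtain i where i: "j = Suc i" using S'(2) by (cases j) auto
      have N': "N - 1 - 2 < N" "4 * i + 2 * r \<le> N - 1 - 2 + 1" using bound i N by auto
      show ?thesis
      proof (rule less.IH[OF N', where f = "\<lambda>S. f (insert (N - 1) S)" and S = S'])
        fix T assume T: "T \<in> path_faces (N - 1 - 2)" "card T = i + r"
        have ins: "insert (N - 1) T \<in> path_faces (N - 1)" "N - 1 \<notin> T"
          using path_faces_insert_last[OF _ T(1)] N2 by auto
        have "insert (N - 1) T \<in> path_faces N" "card (insert (N - 1) T) = j + r"
          using path_faces_mono[OF _ ins(1), of N] ins(2) T i path_faces(2)[OF T(1)] by auto
        from eqs[OF this] have "(\<Sum>S\<in>{S. S \<subseteq> T \<and> card S = j}. f S) +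
            (\<Sum>S\<in>{S. S \<subseteq> T \<and> card S = i}. f (insert (N - 1) S)) = 0"
          using sum_subsets_insert[of T "N - 1" f j] ins(2) path_faces(2)[OF T(1)] i by simp
        moreover have "(\<Sum>S\<in>{S. S \<subseteq> T \<and> card S = j}. f S) = 0"
        proof (rule sum.neutral, rule ballI)
          fix S assume S: "S \<in> {S. S \<subseteq> T \<and> card S = j}"
          then have "S \<in> path_faces (N - 1 - 2)" using path_faces(3)[OF T(1)] by auto
          then have "S \<in> path_faces (N - 2)" by (rule path_faces_mono[rotated]) simp
          then show "f S = 0" using low S by simp
        qed
        ultimately show "(\<Sum>S\<in>{S. S \<subseteq> T \<and> card S = i}. f (insert (N - 1) S)) = 0" by simp
      qed (use S' i in auto)
    qed
    from less.prems(3) N show ?thesis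
    proof (cases rule: path_faces_cases)
      case (with_last S')
      then show ?thesis using last_zero[of S'] less.prems(4) path_faces(2)[OF with_last(3)]
        by simp
    next
      case without
      show ?thesis
      proof (cases "N = 1")
        case True
        then show ?thesis using without low less.prems(4) by simp
      next
        case False
        then have "1 \<le> N - 1" "2 \<le> N" using N by auto
        from without this(1) show ?thesis
        proof (cases rule: path_faces_cases)
          case without
          then show ?thesis using low[of S] less.prems(4) by (simp add: numeral_2_eq_2)
        next
          case (with_last S')
          then show ?thesis using before_last[of S'] \<open>2 \<le> N\<close> less.prems(4) path_faces(2)[OF with_last(3)]
            by simp
        qed
      qed
    qed
  qed
qed

lemma ker_trivial_path:
  assumes "4 * j + 1 \<le> N"
  shows "ker_trivial (\<lambda>_. 1 :: 'k::field_char_0) (path_faces N) j"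
  unfolding ker_trivial_def
proof (intro allI impI ballI)
  fix f :: "nat set \<Rightarrow> 'k" and S
  assume f: "\<forall>T\<in>path_faces N. card T = Suc j \<longrightarrow> (\<Sum>v\<in>T. 1 * f (T - {v})) = 0"
    and S: "S \<in> path_faces N" "card S = j"
  show "f S = 0"
  proof (rule path_power_injective[of j 1 N f S])
    fix T assume T: "T \<in> path_faces N" "card T = j + 1"
    have "{S. S \<subseteq> T \<and> card S = j} = (\<lambda>v. T - {v}) ` T"
    proof (intro Set.set_eqI iffI)
      fix S assume S: "S \<in> {S. S \<subseteq> T \<and> card S = j}"
      have "card (T - S) = 1"
        using S T path_faces(2)[OF T(1)] by (subst card_Diff_subset) (auto intro: finite_subset)
      then obtain v where "T - S = {v}" by (auto simp: card_1_singleton_iff)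
      then show "S \<in> (\<lambda>v. T - {v}) ` T" using S by blast
    qed (use T path_faces(2)[OF T(1)] in auto)
    moreover have "inj_on (\<lambda>v. T - {v}) T" by (auto simp: inj_on_def)
    ultimately show "(\<Sum>S\<in>{S. S \<subseteq> T \<and> card S = j}. f S) = 0"
      using f T by (simp add: sum.reindex)
  qed (use S assms in auto)
qed

text \<open>The transposed analogue: composing the transposes of \<open>\<ell>\<close> and of its divided power.\<close>

lemma sum_supersets_of_cofacets:
  fixes \<phi> :: "'v set \<Rightarrow> 'k::comm_ring_1"
  assumes \<Delta>: "simplicial_complex \<Delta>" and R: "finite R"
    and link: "\<And>v S. S \<in> \<Delta> \<Longrightarrow> insert v R \<subseteq> S \<Longrightarrow> v \<notin> R \<Longrightarrow> v \<in> L" and L: "finite L" "L \<inter> R = {}"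
  shows "(\<Sum>v\<in>L. \<Sum>S\<in>{S\<in>\<Delta>. insert v R \<subseteq> S \<and> card S = d}. \<phi> S) =
         of_nat (d - card R) * (\<Sum>S\<in>{S\<in>\<Delta>. R \<subseteq> S \<and> card S = d}. \<phi> S)"
proof -
  note fin = simplicial_complexD[OF \<Delta>]
  have "(\<Sum>v\<in>L. \<Sum>S\<in>{S\<in>\<Delta>. insert v R \<subseteq> S \<and> card S = d}. \<phi> S) =
        (\<Sum>v\<in>L. \<Sum>S\<in>{S\<in>{S\<in>\<Delta>. R \<subseteq> S \<and> card S = d}. v \<in> S}. \<phi> S)"
    by (intro sum.cong) auto
  also have "\<dots> = (\<Sum>S\<in>{S\<in>\<Delta>. R \<subseteq> S \<and> card S = d}. \<Sum>v\<in>{v\<in>L. v \<in> S}. \<phi> S)"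
    using L fin by (intro sum.swap_restrict) auto
  also have "\<dots> = (\<Sum>S\<in>{S\<in>\<Delta>. R \<subseteq> S \<and> card S = d}. of_nat (d - card R) * \<phi> S)"
  proof (rule sum.cong)
    fix S assume S: "S \<in> {S\<in>\<Delta>. R \<subseteq> S \<and> card S = d}"
    have "{v\<in>L. v \<in> S} = S - R" using link[of S] L S by auto
    then have "card {v\<in>L. v \<in> S} = d - card R"
      using S R by (simp add: card_Diff_subset)
    then show "(\<Sum>v\<in>{v\<in>L. v \<in> S}. \<phi> S) = of_nat (d - card R) * \<phi> S" by simp
  qed simp
  finally show ?thesis by (simp add: sum_distrib_left)
qed

lemma sum_path_faces_insert:
  assumes N: "1 \<le> N"
  shows "(\<Sum>S\<in>{S\<in>path_faces N. R \<subseteq> S \<and> card S = d}. \<phi> S) =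
         (\<Sum>S\<in>{S\<in>path_faces (N - 1). R \<subseteq> S \<and> card S = d}. \<phi> S) +
         (\<Sum>S\<in>{S\<in>path_faces (N - 2). R - {N} \<subseteq> S \<and> Suc (card S) = d}. \<phi> (insert N S))"
proof -
  have eq: "{S\<in>path_faces N. R \<subseteq> S \<and> card S = d} =
      {S\<in>path_faces (N - 1). R \<subseteq> S \<and> card S = d} \<union>
      insert N ` {S\<in>path_faces (N - 2). R - {N} \<subseteq> S \<and> Suc (card S) = d}" (is "?L = ?A \<union> ?B")
  proof (intro Set.set_eqI iffI)
    fix S assume S: "S \<in> ?L"
    then have "S \<in> path_faces N" by simp
    from this N show "S \<in> ?A \<union> ?B"
    proof (cases rule: path_faces_cases)
      case (with_last S')
      then have "S' \<in> {S\<in>path_faces (N - 2). R - {N} \<subseteq> S \<and> Suc (card S) = d}"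
        using S path_faces(2)[OF with_last(3)] by auto
      then show ?thesis using with_last by blast
    qed (use S in auto)
  next
    fix S assume "S \<in> ?A \<union> ?B"
    then show "S \<in> ?L"
    proof
      assume "S \<in> ?B"
      then obtain S' where S': "S = insert N S'" "S' \<in> path_faces (N - 2)" "R - {N} \<subseteq> S'" "Suc (card S') = d"
        by auto
      then show ?thesis using path_faces_insert_last[OF N S'(2)] path_faces(2)[OF S'(2)] by auto
    qed (auto intro: path_faces_mono[of "N - 1"])
  qed
  have "N \<notin> S" if "S \<in> path_faces (N - 1)" for S
    using that N by (auto simp: path_faces_def)
  then have "?A \<inter> ?B = {}" by auto
  moreover have "inj_on (insert N) {S\<in>path_faces (N - 2). R - {N} \<subseteq> S \<and> Suc (card S) = d}"
    using path_faces_insert_last[OF N] unfolding inj_on_def by (metis (no_types, lifting) insert_ident mem_Collect_eq)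
  ultimately show ?thesis
    unfolding eq by (subst sum.union_disjoint) (auto simp: sum.reindex path_faces)
qed

text \<open>The hypothesis says that \<open>\<phi>\<close> is killed by \<open>D\<^sup>r\<close>, where \<open>D\<close> is the transpose of \<open>\<ell>\<close>, which acts as the
  sum of all partial derivatives. Write \<open>\<phi> = \<phi>\<^sub>0 + x\<^sub>N \<phi>\<^sub>1\<close>. The terms with \<open>x\<^sub>N\<close> give
  \<open>D\<^sup>r \<phi>\<^sub>1 = 0\<close> and the others \<open>D\<^sup>r \<phi>\<^sub>0 + r D\<^bsup>r-1\<^esup> \<phi>\<^sub>1 = 0\<close>, so \<open>D\<^bsup>r+1\<^esup> \<phi>\<^sub>0 = 0\<close> on the path with
  \<open>N - 1\<close> vertices: one power more for one vertex less, which yields \<open>\<phi>\<^sub>0 = 0\<close> by induction.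
  Then \<open>D\<^bsup>r-1\<^esup> \<phi>\<^sub>1 = 0\<close> on \<open>N - 2\<close> vertices, in degree \<open>d - 1\<close>, and \<open>\<phi>\<^sub>1 = 0\<close> follows. If \<open>r > d\<close>,
  the hypothesis on \<open>\<phi>\<close> is void, but then the bound on \<open>N\<close> excludes faces of size \<open>d\<close>.
  The power \<open>r = 0\<close> is allowed for every \<open>N\<close>, since the last step reaches it from \<open>N = 1\<close>.\<close>

lemma path_power_coinjective:
  fixes \<phi> :: "nat set \<Rightarrow> 'k::field_char_0"
  assumes "r = 0 \<or> N + r + 1 \<le> 3 * d"
    and "\<And>R. R \<in> path_faces N \<Longrightarrow> card R + r = d \<Longrightarrow>
           (\<Sum>S\<in>{S\<in>path_faces N. R \<subseteq> S \<and> card S = d}. \<phi> S) = 0"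
    and "S \<in> path_faces N" "card S = d"
  shows "\<phi> S = 0"
  using assms
proof (induction N arbitrary: r d \<phi> S rule: less_induct)
  case (less N)
  note eqs = less.prems(2) and S = less.prems(3,4)
  show ?case
  proof (cases "r = 0")
    case True
    have "{S'\<in>path_faces N. S \<subseteq> S' \<and> card S' = d} = {S}"
      using S card_subset_eq[OF path_faces(2)] by blast
    then show ?thesis using eqs[of S] S True by simp
  next
    case r: False
    then have bound: "N + r + 1 \<le> 3 * d" using less.prems(1) by simp
    have N: "1 \<le> N"
      using bound card_path_face[OF S(1)] S(2) r by (cases "N = 0") auto
    have last_eq: "(\<Sum>S\<in>{S\<in>path_faces (N - 2). R \<subseteq> S \<and> Suc (card S) = d}. \<phi> (insert N S)) = 0"
      if R: "R \<in> path_faces (N - 2)" "Suc (card R) + r = d" for R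
    proof -
      note ins = path_faces_insert_last[OF N R(1)]
      have "card (insert N R) + r = d" using ins R path_faces(2)[OF R(1)] by simp
      moreover have "(\<Sum>S\<in>{S\<in>path_faces (N - 1). insert N R \<subseteq> S \<and> card S = d}. \<phi> S) = 0"
        using N by (intro sum.neutral) (auto simp: path_faces_def)
      moreover have "insert N R - {N} = R" using ins by auto
      ultimately show ?thesis
        using eqs[of "insert N R"] ins
        unfolding sum_path_faces_insert[OF N, where R = "insert N R" and d = d and \<phi> = \<phi>] by simp
    qed
    have without_last: "\<phi> S' = 0" if S': "S' \<in> path_faces (N - 1)" "card S' = d" for S'
    proof (rule less.IH[of "N - 1" "Suc r" d \<phi> S'])
      fix R assume R: "R \<in> path_faces (N - 1)" "card R + Suc r = d"
      define L where "L = link_vertices (path_faces (N - 1)) R"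
      have L: "finite L" "L \<inter> R = {}"
        using path_faces(4) by (auto simp: L_def link_vertices_def)
      have d: "card S = d - 1 \<longleftrightarrow> Suc (card S) = d" for S :: "nat set" using R(2) by auto
      have "0 = (\<Sum>v\<in>L. (\<Sum>S\<in>{S\<in>path_faces (N - 1). insert v R \<subseteq> S \<and> card S = d}. \<phi> S) +
          (\<Sum>S\<in>{S\<in>path_faces (N - 2). insert v R \<subseteq> S \<and> card S = d - 1}. \<phi> (insert N S)))"
      proof (rule sum.neutral[symmetric], rule ballI)
        fix v assume v: "v \<in> L"
        then have vR: "v \<notin> R" "insert v R \<in> path_faces (N - 1)" by (auto simp: L_def link_vertices_def)
        then have "insert v R \<in> path_faces N" "card (insert v R) + r = d" "N \<notin> insert v R"
          using R path_faces(2)[OF R(1)] N path_faces_mono[of "N - 1" N] by (auto simp: path_faces_def)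
        from eqs[OF this(1,2)] this(3) d
        show "(\<Sum>S\<in>{S\<in>path_faces (N - 1). insert v R \<subseteq> S \<and> card S = d}. \<phi> S) +
          (\<Sum>S\<in>{S\<in>path_faces (N - 2). insert v R \<subseteq> S \<and> card S = d - 1}. \<phi> (insert N S)) = 0"
          unfolding sum_path_faces_insert[OF N] by simp
      qed
      also have "\<dots> = of_nat (d - card R) * (\<Sum>S\<in>{S\<in>path_faces (N - 1). R \<subseteq> S \<and> card S = d}. \<phi> S) +
          of_nat (d - 1 - card R) *
            (\<Sum>S\<in>{S\<in>path_faces (N - 2). R \<subseteq> S \<and> card S = d - 1}. \<phi> (insert N S))"
      proof -
        have 1: "v \<in> L" if "S \<in> path_faces (N - 1)" "insert v R \<subseteq> S" "v \<notin> R" for v S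
          using that path_faces(3)[OF that(1,2)] by (auto simp: L_def link_vertices_def)
        have 2: "v \<in> L" if "S \<in> path_faces (N - 2)" "insert v R \<subseteq> S" "v \<notin> R" for v S
          using 1[OF path_faces_mono[OF _ that(1)]] that by simp
        note Rfin = path_faces(2)[OF R(1)]
        have "(\<Sum>v\<in>L. \<Sum>S\<in>{S\<in>path_faces (N - 1). insert v R \<subseteq> S \<and> card S = d}. \<phi> S) =
            of_nat (d - card R) * (\<Sum>S\<in>{S\<in>path_faces (N - 1). R \<subseteq> S \<and> card S = d}. \<phi> S)"
          using 1 by (rule sum_supersets_of_cofacets[OF simplicial_complex_path_faces Rfin _ L])
        moreover have "(\<Sum>v\<in>L. \<Sum>S\<in>{S\<in>path_faces (N - 2). insert v R \<subseteq> S \<and> card S = d - 1}. \<phi> (insert N S)) =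
            of_nat (d - 1 - card R) *
              (\<Sum>S\<in>{S\<in>path_faces (N - 2). R \<subseteq> S \<and> card S = d - 1}. \<phi> (insert N S))"
          using 2 by (rule sum_supersets_of_cofacets[OF simplicial_complex_path_faces Rfin _ L])
        ultimately show ?thesis by (simp only: sum.distrib)
      qed
      also have "(\<Sum>S\<in>{S\<in>path_faces (N - 2). R \<subseteq> S \<and> card S = d - 1}. \<phi> (insert N S)) = 0"
      proof (cases "R \<in> path_faces (N - 2)")
        case True
        have "Suc (card R) + r = d" using R(2) by simp
        from last_eq[OF True this] show ?thesis by (simp only: d)
      next
        case False
        then have "{S\<in>path_faces (N - 2). R \<subseteq> S \<and> card S = d - 1} = {}"
          using path_faces(3) by auto
        then show ?thesis by (simp only: sum.empty)
      qed
      also have "d - card R = Suc r" using R(2) by simp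
      finally show "(\<Sum>S\<in>{S\<in>path_faces (N - 1). R \<subseteq> S \<and> card S = d}. \<phi> S) = 0"
        by (simp del: of_nat_Suc)
    qed (use S' bound N in auto)
    from S(1) N show ?thesis
    proof (cases rule: path_faces_cases)
      case without
      then show ?thesis using without_last S(2) by simp
    next
      case (with_last S')
      then have d: "Suc (card S') = d" using S(2) path_faces(2) by auto
      have "\<phi> (insert N S') = 0"
      proof (rule less.IH[of "N - 2" "r - 1" "d - 1" "\<lambda>S. \<phi> (insert N S)" S'])
        \<comment> \<open>For \<open>N = 1\<close> the truncated \<open>N - 2\<close> spoils the inequality, but then \<open>d = 1\<close> and \<open>r = 1\<close>.\<close>
        show "r - 1 = 0 \<or> N - 2 + (r - 1) + 1 \<le> 3 * (d - 1)"
          using bound r N card_path_face[OF S(1)] S(2) by arith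
        fix R assume R: "R \<in> path_faces (N - 2)" "card R + (r - 1) = d - 1"
        have R': "R \<in> path_faces N" "card R + r = d"
          using path_faces_mono[OF _ R(1), of N] R(2) r d by auto
        have "(\<Sum>S\<in>{S\<in>path_faces (N - 1). R \<subseteq> S \<and> card S = d}. \<phi> S) = 0"
          using without_last by (intro sum.neutral) auto
        moreover have "N \<notin> R" using path_faces_insert_last[OF N R(1)] by simp
        moreover have "card S = d - 1 \<longleftrightarrow> Suc (card S) = d" for S :: "nat set" using d by auto
        ultimately show "(\<Sum>S\<in>{S\<in>path_faces (N - 2). R \<subseteq> S \<and> card S = d - 1}. \<phi> (insert N S)) = 0"
          using eqs[OF R'] sum_path_faces_insert[OF N, where R = R and d = d and \<phi> = \<phi>] by simp
      qed (use with_last d N in auto)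
      then show ?thesis using with_last by simp
    qed
  qed
qed

lemma coker_trivial_path:
  assumes "N \<le> 3 * j + 1"
  shows "coker_trivial (\<lambda>_. 1 :: 'k::field_char_0) (path_faces N) j"
  unfolding coker_trivial_def
proof (intro allI impI ballI)
  fix \<phi> :: "nat set \<Rightarrow> 'k" and S
  assume \<phi>: "\<forall>R\<in>path_faces N. card R = j \<longrightarrow> (\<Sum>v\<in>link_vertices (path_faces N) R. 1 * \<phi> (insert v R)) = 0"
    and S: "S \<in> path_faces N" "card S = Suc j"
  show "\<phi> S = 0"
  proof (rule path_power_coinjective[of 1 N "Suc j" \<phi> S])
    fix R assume R: "R \<in> path_faces N" "card R + 1 = Suc j"
    have "{S\<in>path_faces N. R \<subseteq> S \<and> card S = Suc j} = (\<lambda>v. insert v R) ` link_vertices (path_faces N) R"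
    proof (intro Set.set_eqI iffI)
      fix S assume S: "S \<in> {S\<in>path_faces N. R \<subseteq> S \<and> card S = Suc j}"
      have "card (S - R) = 1"
        using S R path_faces(2)[OF R(1)] by (subst card_Diff_subset) auto
      then obtain v where "S - R = {v}" by (auto simp: card_1_singleton_iff)
      then have "S = insert v R" "v \<notin> R" using S by blast+
      then show "S \<in> (\<lambda>v. insert v R) ` link_vertices (path_faces N) R" using S by (auto simp: link_vertices_def)
    qed (use R path_faces(2)[OF R(1)] in \<open>auto simp: link_vertices_def\<close>)
    moreover have "inj_on (\<lambda>v. insert v R) (link_vertices (path_faces N) R)" by (auto simp: inj_on_def link_vertices_def)
    ultimately show "(\<Sum>S\<in>{S\<in>path_faces N. R \<subseteq> S \<and> card S = Suc j}. \<phi> S) = 0"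
      using \<phi> R by (simp add: sum.reindex)
  qed (use S assms in auto)
qed

section \<open>Failure of injectivity and surjectivity on a path\<close>

text \<open>The fibres are the quadruples of consecutive vertices, with signs \<open>+ + - -\<close>: two vertices of a
  face in one quadruple are not adjacent, so they lie in different halves. The bound
  \<open>4 j \<le> N + 3\<close> provides the face of the first vertices of all quadruples.\<close>

lemma not_ker_trivial_path:
  assumes "N \<le> 4 * j" "4 * j \<le> N + 3"
  shows "\<not> ker_trivial (\<lambda>_. 1 :: 'k::field) (path_faces N) j"
proof (rule not_ker_trivial_if_signs_cancel[OF simplicial_complex_path_faces,
        where e = "\<lambda>v. (v - 1) div 4" and s = "\<lambda>v. if (v - 1) mod 4 < 2 then 1 else - 1"
          and S = "(\<lambda>i. 4 * i + 1) ` {..<j}"])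
  fix v assume "v \<in> \<Union>(path_faces N)"
  then have "1 \<le> v" "v \<le> N" by (auto simp: path_faces_def)
  then show "(v - 1) div 4 < j" using assms by linarith
next
  fix T u v assume *: "T \<in> path_faces N" "u \<in> T" "v \<in> T" "u \<noteq> v" "(u - 1) div 4 = (v - 1) div 4"
  then have "1 \<le> u" "1 \<le> v" "u \<noteq> Suc v" "v \<noteq> Suc u" by (auto simp: path_faces_def)
  moreover have "u - 1 = 4 * ((v - 1) div 4) + (u - 1) mod 4" "v - 1 = 4 * ((v - 1) div 4) + (v - 1) mod 4"
    using *(5) by (metis mult_div_mod_eq)+
  moreover have "(u - 1) mod 4 < 4" "(v - 1) mod 4 < 4" by simp_all
  ultimately have "(u - 1) mod 4 < 2 \<longleftrightarrow> \<not> (v - 1) mod 4 < 2" using *(4) by linarith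
  then show "(if (u - 1) mod 4 < 2 then 1 else - 1) + (if (v - 1) mod 4 < 2 then 1 else - 1 :: 'k) = 0"
    by simp
next
  show "(\<lambda>i. 4 * i + 1) ` {..<j} \<in> path_faces N"
    using assms by (auto simp: path_faces_def) presburger
  show "card ((\<lambda>i. 4 * i + 1) ` {..<j}) = j" by (subst card_image) (auto simp: inj_on_def)
  show "inj_on (\<lambda>v. (v - 1) div 4) ((\<lambda>i. 4 * i + 1) ` {..<j})" by (auto simp: inj_on_def)
qed auto

lemma sum_mod3_pair:
  fixes i :: nat
  shows "(\<Sum>v\<in>{v. v mod 3 \<noteq> 0 \<and> v div 3 = i}. if v mod 3 = 1 then 1 else - 1 :: 'k::comm_ring_1) = 0"
proof -
  have "{v. v mod 3 \<noteq> 0 \<and> v div 3 = i} = {3 * i + 1, 3 * i + 2}"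
    by (intro Set.set_eqI) (simp, presburger)
  moreover have "(3 * i + 1) mod 3 = 1" "(3 * i + 2) mod 3 \<noteq> 1" by presburger+
  moreover have "(\<Sum>v\<in>{3 * i + 1, 3 * i + 2}. g v) = g (3 * i + 1) + g (3 * i + 2)" for g :: "nat \<Rightarrow> 'k"
    by simp
  ultimately show ?thesis by (simp only: if_True if_False) simp
qed

text \<open>The edges \<open>{3 i + 1, 3 i + 2}\<close> form an induced matching.\<close>

lemma not_coker_trivial_path:
  assumes "3 * j + 2 \<le> N"
  shows "\<not> coker_trivial (\<lambda>_. 1 :: 'k::field) (path_faces N) j"
proof (rule not_coker_trivial_if_signs_cancel[OF simplicial_complex_path_faces,
        where M = "{v. v mod 3 \<noteq> 0 \<and> v div 3 \<le> j}" and e = "\<lambda>v. v div 3"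
          and s = "\<lambda>v. if v mod 3 = 1 then 1 else - 1" and S = "(\<lambda>i. 3 * i + 1) ` {..j}"])
  have "{v. v mod 3 \<noteq> 0 \<and> v div 3 \<le> j} \<subseteq> {..3 * j + 2}" by (auto; presburger)
  then show "finite {v. v mod 3 \<noteq> 0 \<and> v div 3 \<le> j}" by (rule finite_subset) simp
next
  fix S assume S: "S \<subseteq> {v. v mod 3 \<noteq> 0 \<and> v div 3 \<le> j}" "inj_on (\<lambda>v. v div 3) S"
  have "1 \<le> v \<and> v \<le> N" if "v \<in> S" for v
  proof -
    have "v mod 3 \<noteq> 0" "v div 3 \<le> j" using S(1) that by auto
    then show ?thesis using assms by presburger
  qed
  moreover have "Suc v \<notin> S" if "v \<in> S" for v
  proof
    assume "Suc v \<in> S"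
    then have "v div 3 \<noteq> Suc v div 3" "v mod 3 \<noteq> 0" "Suc v mod 3 \<noteq> 0"
      using S that by (auto dest: inj_onD[of _ _ v "Suc v"])
    then show False by presburger
  qed
  ultimately show "S \<in> path_faces N" by (auto simp: path_faces_def)
next
  fix i assume "i \<le> j"
  then have "{v\<in>{v. v mod 3 \<noteq> 0 \<and> v div 3 \<le> j}. v div 3 = i} = {v. v mod 3 \<noteq> 0 \<and> v div 3 = i}"
    by auto
  then show "(\<Sum>v\<in>{v\<in>{v. v mod 3 \<noteq> 0 \<and> v div 3 \<le> j}. v div 3 = i}.
      if v mod 3 = 1 then 1 else - 1 :: 'k) = 0"
    by (simp only: sum_mod3_pair)
next
  show "(\<lambda>i. 3 * i + 1) ` {..j} \<subseteq> {v. v mod 3 \<noteq> 0 \<and> v div 3 \<le> j}" by auto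
  show "card ((\<lambda>i. 3 * i + 1) ` {..j}) = Suc j" by (subst card_image) (auto simp: inj_on_def)
  show "inj_on (\<lambda>v. v div 3) ((\<lambda>i. 3 * i + 1) ` {..j})" by (auto simp: inj_on_def)
qed auto

section \<open>The independence complex of a lollipop graph\<close>

definition independent_sets :: "'v set \<Rightarrow> 'v set set \<Rightarrow> 'v set set" where
  "independent_sets V E = {S. S \<subseteq> V \<and> (\<forall>u\<in>S. \<forall>v\<in>S. u \<noteq> v \<longrightarrow> {u, v} \<notin> E)}"

lemma simplicial_complex_independent_sets:
  assumes "finite V"
  shows "simplicial_complex (independent_sets V E)"
proof -
  have "\<Union>(independent_sets V E) \<subseteq> V" by (auto simp: independent_sets_def)
  then have "finite (\<Union>(independent_sets V E))" using assms by (rule finite_subset)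
  then show ?thesis unfolding simplicial_complex_def independent_sets_def by blast
qed

abbreviation lollipop_faces :: "nat \<Rightarrow> nat \<Rightarrow> lollipop_vertex set set" where
  "lollipop_faces m n \<equiv> independent_sets (lollipop_vertices m n) (lollipop_edges m n)"

lemma finite_lollipop_vertices: "finite (lollipop_vertices m n)"
  by (simp add: lollipop_vertices_def)

lemmas simplicial_complex_lollipop = simplicial_complex_independent_sets[OF finite_lollipop_vertices]

lemma lollipop_faces_iff:
  "S \<in> lollipop_faces m n \<longleftrightarrow>
     S \<subseteq> lollipop_vertices m n \<and> (\<forall>i i'. X i \<in> S \<longrightarrow> X i' \<in> S \<longrightarrow> i = i') \<and>
     \<not> (X m \<in> S \<and> Y 1 \<in> S) \<and> (\<forall>k. Y k \<in> S \<longrightarrow> Y (Suc k) \<notin> S)"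
  (is "_ \<longleftrightarrow> ?V \<and> ?X \<and> ?B \<and> ?Y")
proof
  assume S: "S \<in> lollipop_faces m n"
  then have V: "S \<subseteq> lollipop_vertices m n"
    and indep: "\<And>u v. u \<in> S \<Longrightarrow> v \<in> S \<Longrightarrow> u \<noteq> v \<Longrightarrow> {u, v} \<notin> lollipop_edges m n"
    by (auto simp: independent_sets_def)
  have X_edge: "{X i, X i'} \<in> lollipop_edges m n" if "1 \<le> i" "i < i'" "i' \<le> m" for i i'
    unfolding lollipop_edges_def using that by blast
  have "i = i'" if "X i \<in> S" "X i' \<in> S" for i i'
  proof (rule ccontr)
    assume "i \<noteq> i'"
    moreover have "1 \<le> i" "i \<le> m" "1 \<le> i'" "i' \<le> m"
      using V that by (auto simp: lollipop_vertices_def)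
    ultimately have "{X i, X i'} \<in> lollipop_edges m n"
      using X_edge[of i i'] X_edge[of i' i] by (cases "i < i'") (auto simp: insert_commute)
    then show False using indep[OF that] \<open>i \<noteq> i'\<close> by simp
  qed
  moreover have ?B using indep[of "X m" "Y 1"] by (auto simp: lollipop_edges_def)
  moreover have "Y (Suc k) \<notin> S" if "Y k \<in> S" for k
  proof
    assume "Y (Suc k) \<in> S"
    moreover from this have "1 \<le> k" "k + 1 \<le> n"
      using V that by (auto simp: lollipop_vertices_def)
    then have "{Y k, Y (k + 1)} \<in> lollipop_edges m n"
      unfolding lollipop_edges_def by blast
    ultimately show False using indep[OF that] by force
  qed
  ultimately show "?V \<and> ?X \<and> ?B \<and> ?Y" using V by blast
next
  assume S: "?V \<and> ?X \<and> ?B \<and> ?Y"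
  have "{u, v} \<notin> lollipop_edges m n" if "u \<in> S" "v \<in> S" for u v
  proof
    assume "{u, v} \<in> lollipop_edges m n"
    then consider i j where "i < j" "{u, v} = {X i, X j}" | "{u, v} = {X m, Y 1}"
      | k where "{u, v} = {Y k, Y (Suc k)}"
      unfolding lollipop_edges_def by auto
    then show False
    proof cases
      case (1 i j)
      then have "X i \<in> S" "X j \<in> S" using that by (metis insertCI insertE singletonD)+
      then show False using S 1(1) by blast
    next
      case 2
      then have "X m \<in> S" "Y 1 \<in> S" using that by (metis insertCI insertE singletonD)+
      then show False using S by blast
    next
      case (3 k)
      then have "Y k \<in> S" "Y (Suc k) \<in> S" using that by (metis insertCI insertE singletonD)+
      then show False using S by blast
    qed
  qed
  then show "S \<in> lollipop_faces m n" using S by (auto simp: independent_sets_def)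
qed

text \<open>The lollipop folds onto a path whose first vertex is the image of all clique vertices but the
  bridge vertex \<open>X m\<close>. If \<open>m = 1\<close> there are no such vertices, and \<open>X 1\<close> itself is the first
  vertex of the path; this is why the tail is shifted by \<open>min m 2\<close>.\<close>

definition fold_clique :: "nat \<Rightarrow> lollipop_vertex \<Rightarrow> nat" where
  "fold_clique m v = (case v of X i \<Rightarrow> if i = m then min m 2 else 1 | Y k \<Rightarrow> k + min m 2)"

text \<open>Sections of the folding map: the induced path that enters the clique at \<open>X i\<close>.\<close>

definition include_path :: "nat \<Rightarrow> nat \<Rightarrow> nat \<Rightarrow> lollipop_vertex" where
  "include_path m i p =
     (if p > min m 2 then Y (p - min m 2) else if p = min m 2 then X m else X i)"

lemma nondegenerate_fold_clique:
  assumes "1 \<le> m"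
  shows "nondegenerate_map (fold_clique m) (lollipop_faces m n) (path_faces (n + min m 2))"
  unfolding nondegenerate_map_def
proof (intro ballI conjI)
  fix S assume "S \<in> lollipop_faces m n"
  then have S: "\<And>v. v \<in> S \<Longrightarrow> v \<in> lollipop_vertices m n" "\<And>i i'. X i \<in> S \<Longrightarrow> X i' \<in> S \<Longrightarrow> i = i'"
    "X m \<in> S \<Longrightarrow> Y (Suc 0) \<notin> S" "\<And>k. Y k \<in> S \<Longrightarrow> Y (Suc k) \<notin> S"
    by (auto simp: lollipop_faces_iff)
  have pos: "1 \<le> k \<and> k \<le> n" if "Y k \<in> S" for k using S(1)[OF that] by (auto simp: lollipop_vertices_def)
  have posX: "1 \<le> i \<and> i \<le> m" if "X i \<in> S" for i using S(1)[OF that] by (auto simp: lollipop_vertices_def)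
  show "inj_on (fold_clique m) S"
  proof (rule inj_onI)
    fix u v assume "u \<in> S" "v \<in> S" "fold_clique m u = fold_clique m v"
    then show "u = v"
    proof (cases u; cases v)
      fix i i' assume "u = X i" "v = X i'"
      then show "u = v" using S(2) \<open>u \<in> S\<close> \<open>v \<in> S\<close> by simp
    next
      fix i k assume "u = X i" "v = Y k"
      then show "u = v" using pos[of k] \<open>v \<in> S\<close> \<open>fold_clique m u = fold_clique m v\<close> assms
        by (auto simp: fold_clique_def split: if_splits)
    next
      fix i k assume "u = Y k" "v = X i"
      then show "u = v" using pos[of k] \<open>u \<in> S\<close> \<open>fold_clique m u = fold_clique m v\<close> assms
        by (auto simp: fold_clique_def split: if_splits)
    qed (simp add: fold_clique_def)
  qed
  have "1 \<le> fold_clique m v \<and> fold_clique m v \<le> n + min m 2" if "v \<in> S" for v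
    using that pos assms by (cases v) (auto simp: fold_clique_def)
  moreover have "Suc (fold_clique m u) \<noteq> fold_clique m v" if "u \<in> S" "v \<in> S" for u v
  proof
    assume eq: "Suc (fold_clique m u) = fold_clique m v"
    show False
    proof (cases u; cases v)
      fix i k assume [simp]: "u = X i" "v = Y k"
      have "k = 1" "i = m" using eq that pos[of k] posX[of i] by (auto simp: fold_clique_def split: if_splits)
      then show False using S(3) that by simp
    next
      fix k k' assume [simp]: "u = Y k" "v = Y k'"
      then show False using eq S(4) that by (auto simp: fold_clique_def)
    next
      fix i i' assume [simp]: "u = X i" "v = X i'"
      then show False using eq S(2)[of i i'] that by (auto simp: fold_clique_def)
    next
      fix i k assume [simp]: "u = Y k" "v = X i"
      then show False using eq pos[of k] that assms by (auto simp: fold_clique_def split: if_splits)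
    qed
  qed
  ultimately show "fold_clique m ` S \<in> path_faces (n + min m 2)"
    unfolding path_faces_def by force
qed

lemma nondegenerate_include_path:
  assumes "1 \<le> i" "i < m \<or> m = 1"
  shows "nondegenerate_map (include_path m i) (path_faces (n + min m 2)) (lollipop_faces m n)"
    and "\<And>S. S \<in> path_faces (n + min m 2) \<Longrightarrow> fold_clique m ` include_path m i ` S = S"
proof -
  have inv: "fold_clique m (include_path m i p) = p" if "1 \<le> p" for p
    using assms that by (auto simp: fold_clique_def include_path_def)
  have pos: "1 \<le> p" "p \<le> n + min m 2" if "S \<in> path_faces (n + min m 2)" "p \<in> S" for S p
    using that by (auto simp: path_faces_def)
  show "fold_clique m ` include_path m i ` S = S" if "S \<in> path_faces (n + min m 2)" for S
  proof -
    have "(\<lambda>p. fold_clique m (include_path m i p)) ` S = (\<lambda>p. p) ` S"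
      using inv pos[OF that] by (intro image_cong) auto
    then show ?thesis by (simp add: image_image)
  qed
  show "nondegenerate_map (include_path m i) (path_faces (n + min m 2)) (lollipop_faces m n)"
    unfolding nondegenerate_map_def
  proof (intro ballI conjI)
    fix S assume S: "S \<in> path_faces (n + min m 2)"
    show "inj_on (include_path m i) S"
      by (rule inj_on_inverseI[where g = "fold_clique m"]) (use inv pos[OF S] in auto)
    have nonadj: "Suc p \<notin> S" if "p \<in> S" for p using S that by (auto simp: path_faces_def)
    have X: "include_path m i p = X k \<longleftrightarrow> p \<le> min m 2 \<and> k = (if p = min m 2 then m else i)"
      and Y: "include_path m i p = Y k \<longleftrightarrow> p > min m 2 \<and> p = k + min m 2" for p k
      by (auto simp: include_path_def)
    have XS: "X k \<in> include_path m i ` S \<longleftrightarrow> (\<exists>p\<in>S. p \<le> min m 2 \<and> k = (if p = min m 2 then m else i))" for k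
      unfolding image_iff by (subst eq_commute) (simp only: X)
    have YS: "Y k \<in> include_path m i ` S \<longleftrightarrow> k + min m 2 \<in> S \<and> 0 < k" for k
    proof -
      have "Y k \<in> include_path m i ` S \<longleftrightarrow> (\<exists>p\<in>S. p > min m 2 \<and> p = k + min m 2)"
        unfolding image_iff by (subst eq_commute) (simp only: Y)
      then show ?thesis by (auto intro!: bexI[of _ "k + min m 2"])
    qed
    have eq: "p = q" if "p \<in> S" "q \<in> S" "p \<le> min m 2" "q \<le> min m 2" for p q
    proof -
      have "1 \<le> p" "1 \<le> q" "Suc p \<noteq> q" "Suc q \<noteq> p" using pos[OF S] nonadj that by auto
      then show ?thesis using that by linarith
    qed
    have "k = k'" if kk: "X k \<in> include_path m i ` S" "X k' \<in> include_path m i ` S" for k k'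
    proof -
      obtain p where "p \<in> S" "p \<le> min m 2" "k = (if p = min m 2 then m else i)"
        using kk(1) XS[of k] by blast
      moreover obtain q where "q \<in> S" "q \<le> min m 2" "k' = (if q = min m 2 then m else i)"
        using kk(2) XS[of k'] by blast
      ultimately show ?thesis using eq[of p q] by simp
    qed
    moreover have "include_path m i p \<in> lollipop_vertices m n" if "p \<in> S" for p
    proof -
      have "p - min m 2 \<le> n" "p < min m 2 \<longrightarrow> i \<le> m" using pos[OF S that] assms by auto
      then show ?thesis using assms by (auto simp: include_path_def lollipop_vertices_def)
    qed
    then have "include_path m i ` S \<subseteq> lollipop_vertices m n" by blast
    moreover have "\<not> (X m \<in> include_path m i ` S \<and> Y 1 \<in> include_path m i ` S)"
    proof
      assume "X m \<in> include_path m i ` S \<and> Y 1 \<in> include_path m i ` S"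
      then obtain p where p: "p \<in> S" "p \<le> min m 2" "m = (if p = min m 2 then m else i)" "Suc (min m 2) \<in> S"
        unfolding XS YS by auto
      then have "p = min m 2" using assms pos[OF S p(1)] by (auto split: if_splits)
      then show False using p nonadj by auto
    qed
    moreover have "\<forall>k. Y k \<in> include_path m i ` S \<longrightarrow> Y (Suc k) \<notin> include_path m i ` S"
      unfolding YS using nonadj by auto
    ultimately show "include_path m i ` S \<in> lollipop_faces m n"
      unfolding lollipop_faces_iff by (intro conjI allI impI) blast+
  qed
qed

text \<open>An independent set contains at most one clique vertex, so it lies on one of these induced paths.\<close>

lemma lollipop_face_in_path:
  assumes "1 \<le> m" "S \<in> lollipop_faces m n"
  obtains i where "1 \<le> i" "i < m \<or> m = 1" "include_path m i ` fold_clique m ` S = S"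
proof -
  define i where "i = (if \<exists>k<m. X k \<in> S then SOME k. k < m \<and> X k \<in> S else 1)"
  have uniq: "k = k'" if "X k \<in> S" "X k' \<in> S" for k k' using that assms by (auto simp: lollipop_faces_iff)
  have V: "S \<subseteq> lollipop_vertices m n" using assms by (simp add: lollipop_faces_iff)
  have pos: "1 \<le> k \<and> k \<le> m" if "X k \<in> S" for k
    using that V by (auto simp: lollipop_vertices_def)
  have posY: "1 \<le> k \<and> k \<le> n" if "Y k \<in> S" for k
    using that V by (auto simp: lollipop_vertices_def)
  have i: "k = i" if "X k \<in> S" "k \<noteq> m" for k
  proof -
    have k: "k < m \<and> X k \<in> S" using that pos[of k] by auto
    then have "(SOME k. k < m \<and> X k \<in> S) = k" using uniq by (intro some_equality) auto
    then show ?thesis using k by (auto simp: i_def)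
  qed
  have "1 \<le> i \<and> (i < m \<or> m = 1)"
  proof (cases "\<exists>k<m. X k \<in> S")
    case True
    then show ?thesis using i pos by (metis less_irrefl)
  next
    case False
    then show ?thesis using assms(1) by (auto simp: i_def)
  qed
  moreover have "include_path m i (fold_clique m v) = v" if "v \<in> S" for v
    using that i pos posY assms(1)
    by (cases v) (fastforce simp: include_path_def fold_clique_def)+
  then have "include_path m i ` fold_clique m ` S = S" by (force simp: image_iff)
  ultimately show thesis using that by blast
qed

lemma ker_trivial_lollipop_iff:
  assumes "1 \<le> m"
  shows "ker_trivial (\<lambda>_. 1 :: 'k::field) (lollipop_faces m n) j \<longleftrightarrow>
         ker_trivial (\<lambda>_. 1 :: 'k) (path_faces (n + min m 2)) j"
proof
  assume "ker_trivial (\<lambda>_. 1 :: 'k) (lollipop_faces m n) j"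
  then show "ker_trivial (\<lambda>_. 1 :: 'k) (path_faces (n + min m 2)) j"
  proof (rule ker_trivial_pullback)
    fix S assume S: "S \<in> path_faces (n + min m 2)"
    have "(1::nat) \<le> 1" "1 < m \<or> m = 1" using assms by auto
    note incl = nondegenerate_include_path[OF this]
    show "\<exists>\<pi> S'. nondegenerate_map \<pi> (lollipop_faces m n) (path_faces (n + min m 2)) \<and>
        S' \<in> lollipop_faces m n \<and> \<pi> ` S' = S"
      using nondegenerate_fold_clique[OF assms, of n] incl(1)[of n] incl(2)[OF S] S
      unfolding nondegenerate_map_def by blast
  qed
next
  assume "ker_trivial (\<lambda>_. 1 :: 'k) (path_faces (n + min m 2)) j"
  then show "ker_trivial (\<lambda>_. 1 :: 'k) (lollipop_faces m n) j"
  proof (rule ker_trivial_pullback)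
    fix S assume S: "S \<in> lollipop_faces m n"
    obtain i where "1 \<le> i" "i < m \<or> m = 1" "include_path m i ` fold_clique m ` S = S"
      using lollipop_face_in_path[OF assms S] by blast
    then show "\<exists>\<pi> S'. nondegenerate_map \<pi> (path_faces (n + min m 2)) (lollipop_faces m n) \<and>
        S' \<in> path_faces (n + min m 2) \<and> \<pi> ` S' = S"
      using nondegenerate_include_path(1)[of i m n] nondegenerate_fold_clique[OF assms, of n] S
      unfolding nondegenerate_map_def by blast
  qed
qed

lemma coker_trivial_lollipop_iff_small:
  assumes "1 \<le> m" "m \<le> 2"
  shows "coker_trivial (\<lambda>_. 1 :: 'k::field) (lollipop_faces m n) j \<longleftrightarrow>
         coker_trivial (\<lambda>_. 1 :: 'k) (path_faces (n + min m 2)) j"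
proof
  have incl: "(1::nat) \<le> 1" "1 < m \<or> m = 1" using assms by auto
  have "fold_clique m (include_path m 1 p) = p" if "1 \<le> p" for p
    using assms that by (auto simp: fold_clique_def include_path_def)
  then have "inj_on (include_path m 1) (\<Union>(path_faces (n + min m 2)))"
    by (intro inj_on_inverseI[where g = "fold_clique m"]) (auto simp: path_faces_def)
  moreover assume "coker_trivial (\<lambda>_. 1 :: 'k) (lollipop_faces m n) j"
  ultimately show "coker_trivial (\<lambda>_. 1 :: 'k) (path_faces (n + min m 2)) j"
    by (rule coker_trivial_pushforward[OF simplicial_complex_path_faces simplicial_complex_lollipop
          nondegenerate_include_path(1)[OF incl]])
next
  have "include_path m 1 (fold_clique m v) = v" if "v \<in> lollipop_vertices m n" for v
  proof -
    have "m = 1 \<or> m = 2" using assms by auto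
    then show ?thesis
      using that by (elim disjE)
        (auto simp: lollipop_vertices_def fold_clique_def include_path_def split: if_splits)
  qed
  moreover have "\<Union>(lollipop_faces m n) \<subseteq> lollipop_vertices m n"
    by (auto simp: independent_sets_def)
  ultimately have "inj_on (fold_clique m) (\<Union>(lollipop_faces m n))"
    by (intro inj_on_inverseI[where g = "include_path m 1"]) blast
  moreover assume "coker_trivial (\<lambda>_. 1 :: 'k) (path_faces (n + min m 2)) j"
  ultimately show "coker_trivial (\<lambda>_. 1 :: 'k) (lollipop_faces m n) j"
    by (rule coker_trivial_pushforward[OF simplicial_complex_lollipop simplicial_complex_path_faces
          nondegenerate_fold_clique[OF assms(1)]])
qed

lemma insert_X_image_Y_face:
  assumes "1 \<le> i" "i < m"
  shows "insert (X i) (Y ` R) \<in> lollipop_faces m n \<longleftrightarrow> R \<in> path_faces n"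
proof -
  have "insert (X i) (Y ` R) \<subseteq> lollipop_vertices m n \<longleftrightarrow> R \<subseteq> {1..n}"
    using assms by (auto simp: lollipop_vertices_def)
  moreover have "(\<forall>k. Y k \<in> insert (X i) (Y ` R) \<longrightarrow> Y (Suc k) \<notin> insert (X i) (Y ` R)) \<longleftrightarrow>
      (\<forall>k\<in>R. Suc k \<notin> R)"
    by auto
  moreover have "X m \<notin> insert (X i) (Y ` R)" using assms by auto
  moreover have "\<forall>k k'. X k \<in> insert (X i) (Y ` R) \<longrightarrow> X k' \<in> insert (X i) (Y ` R) \<longrightarrow> k = k'"
    by auto
  ultimately show ?thesis unfolding lollipop_faces_iff path_faces_def by blast
qed

text \<open>Let \<open>\<phi>\<close> be in the transposed kernel. The coefficients of \<open>\<phi>\<close> at \<open>x\<^sub>i\<close>, for a clique vertex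
  \<open>i < m\<close>, form an element of the transposed kernel of the tail in degree one less, since in the
  lollipop a face with such a vertex can only be extended along the tail. On faces without such a vertex,
  \<open>\<phi>\<close> agrees with its push-forward to the path with \<open>n + 2\<close> vertices.\<close>

lemma coker_trivial_lollipop_large:
  assumes m: "3 \<le> m" and n: "n + 2 \<le> 3 * j"
  shows "coker_trivial (\<lambda>_. 1 :: 'k::field_char_0) (lollipop_faces m n) j"
  unfolding coker_trivial_def
proof (intro allI impI ballI)
  let ?L = "lollipop_faces m n"
  note fin = simplicial_complexD[OF simplicial_complex_lollipop]
  fix \<phi> :: "lollipop_vertex set \<Rightarrow> 'k" and S
  assume \<phi>: "\<forall>R\<in>?L. card R = j \<longrightarrow> (\<Sum>v\<in>link_vertices ?L R. 1 * \<phi> (insert v R)) = 0"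
    and S: "S \<in> ?L" "card S = Suc j"
  have V: "T \<subseteq> lollipop_vertices m n" if "T \<in> ?L" for T using that by (simp add: lollipop_faces_iff)
  show "\<phi> S = 0"
  proof (cases "\<exists>i. X i \<in> S \<and> i < m")
    case True
    then obtain i where i: "X i \<in> S" "1 \<le> i" "i < m"
      using V[OF S(1)] by (auto simp: lollipop_vertices_def)
    have X_unique: "i' = i" if "T \<in> ?L" "X i \<in> T" "X i' \<in> T" for T i'
      using that by (auto simp: lollipop_faces_iff)
    obtain j' where j: "j = Suc j'" using n by (cases j) auto
    have card: "card (insert (X i) (Y ` R)) = Suc (card R)" if "R \<in> path_faces n" for R
      using path_faces(2)[OF that] by (subst card_insert_disjoint) (auto simp: card_image inj_on_def)
    have coker: "coker_trivial (\<lambda>_. 1 :: 'k) (path_faces n) j'"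
      using n j by (intro coker_trivial_path) simp
    have link_sum: "(\<Sum>v\<in>link_vertices (path_faces n) R. 1 * \<phi> (insert (X i) (Y ` insert v R))) = 0"
      if R: "R \<in> path_faces n" "card R = j'" for R
    proof -
      let ?R = "insert (X i) (Y ` R)"
      have swap: "insert (Y v) ?R = insert (X i) (Y ` insert v R)" for v by auto
      have "link_vertices ?L ?R = Y ` link_vertices (path_faces n) R"
      proof (intro Set.set_eqI iffI)
        fix v assume v: "v \<in> link_vertices ?L ?R"
        then have "v \<noteq> X i'" for i' using X_unique[of "insert v ?R" i'] by (auto simp: link_vertices_def)
        then obtain k where k: "v = Y k" by (cases v) auto
        then have "k \<notin> R" "insert k R \<in> path_faces n"
          using v insert_X_image_Y_face[OF i(2,3), of "insert k R" n] swap[of k] by (auto simp: link_vertices_def)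
        then show "v \<in> Y ` link_vertices (path_faces n) R" by (auto simp: k link_vertices_def)
      next
        fix v assume "v \<in> Y ` link_vertices (path_faces n) R"
        then obtain k where "v = Y k" "k \<notin> R" "insert k R \<in> path_faces n" by (auto simp: link_vertices_def)
        then show "v \<in> link_vertices ?L ?R"
          using insert_X_image_Y_face[OF i(2,3), of "insert k R" n] swap[of k] by (auto simp: link_vertices_def)
      qed
      moreover have "?R \<in> ?L" "card ?R = j"
        using insert_X_image_Y_face[OF i(2,3)] card R j by auto
      then have "(\<Sum>v\<in>link_vertices ?L ?R. 1 * \<phi> (insert v ?R)) = 0" using \<phi> by blast
      moreover have "inj_on Y (link_vertices (path_faces n) R)" by (auto simp: inj_on_def)
      ultimately show ?thesis by (simp add: sum.reindex swap)
    qed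
    define R where "R = {k. Y k \<in> S}"
    have SR: "S = insert (X i) (Y ` R)"
    proof (intro Set.set_eqI iffI)
      fix v assume "v \<in> S"
      then show "v \<in> insert (X i) (Y ` R)" using X_unique[OF S(1) i(1)] by (cases v) (auto simp: R_def)
    qed (use i(1) in \<open>auto simp: R_def\<close>)
    then have R: "R \<in> path_faces n" using S(1) insert_X_image_Y_face[OF i(2,3)] by simp
    have "\<phi> (insert (X i) (Y ` R)) = 0"
      by (rule coker_trivial_onesD[OF coker R, where \<phi> = "\<lambda>R. \<phi> (insert (X i) (Y ` R))"])
        (use card[OF R] S(2) j SR link_sum in auto)
    then show ?thesis using SR by simp
  next
    case False
    define W where "W = insert (X m) (Y ` {1..n})"
    have small: "min m 2 = 2" using m by simp
    have inj: "inj_on (fold_clique m) W"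
      by (rule inj_on_inverseI[where g = "include_path m 1"])
        (auto simp: W_def fold_clique_def include_path_def small)
    have W: "T \<subseteq> W" if T: "T \<in> ?L" "1 \<notin> fold_clique m ` T" for T
    proof
      fix v assume v: "v \<in> T"
      then have "fold_clique m v \<noteq> 1" using T(2) by (metis image_eqI)
      then show "v \<in> W" using V[OF T(1)] v
        by (auto simp: W_def lollipop_vertices_def fold_clique_def split: if_splits)
    qed
    have no_1: "1 \<notin> fold_clique m ` S"
    proof
      assume "1 \<in> fold_clique m ` S"
      then obtain v where v: "v \<in> S" "fold_clique m v = 1" by auto
      then obtain i where i: "v = X i" "i \<noteq> m"
        using small by (cases v) (auto simp: fold_clique_def split: if_splits)
      moreover have "v \<in> lollipop_vertices m n" using V[OF S(1)] v(1) by blast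
      ultimately show False using False v(1) by (auto simp: lollipop_vertices_def)
    qed
    have "T = S" if "T \<in> ?L" "fold_clique m ` T = fold_clique m ` S" for T
      using inj_on_image_eq_iff[OF inj, of T S] W[of T] W[of S] that S(1) no_1 by simp
    then have single: "{T\<in>?L. fold_clique m ` T = fold_clique m ` S} = {S}" using S(1) by auto
    have nondeg: "nondegenerate_map (fold_clique m) ?L (path_faces (n + 2))"
      using nondegenerate_fold_clique[of m n] m small by simp
    then have face: "fold_clique m ` S \<in> path_faces (n + 2)" "card (fold_clique m ` S) = Suc j"
      using S by (auto simp: nondegenerate_map_def card_image)
    have coker: "coker_trivial (\<lambda>_. 1 :: 'k) (path_faces (n + 2)) j"
      using n by (intro coker_trivial_path) simp
    have "(\<Sum>T\<in>{T\<in>?L. fold_clique m ` T = fold_clique m ` S}. \<phi> T) = 0"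
      by (rule coker_trivial_onesD[OF coker face, where \<phi> = "\<lambda>S'. \<Sum>T\<in>{T\<in>?L. fold_clique m ` T = S'}. \<phi> T"])
        (rule coker_pushforward[OF simplicial_complex_lollipop simplicial_complex_path_faces nondeg \<phi>])
    then show ?thesis using single by simp
  qed
qed

text \<open>An induced matching: the edges \<open>{3 i + 1, 3 i + 2}\<close> of the tail for \<open>i < j\<close>, together with the
  clique edge \<open>{X 1, X 2}\<close>, which has no neighbour in the tail as \<open>m \<ge> 3\<close>.\<close>

lemma not_coker_trivial_lollipop_large:
  assumes m: "3 \<le> m" and n: "3 * j \<le> n + 1"
  shows "\<not> coker_trivial (\<lambda>_. 1 :: 'k::field) (lollipop_faces m n) j"
proof (rule not_coker_trivial_if_signs_cancel[OF simplicial_complex_lollipop,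
        where M = "{X 1, X 2} \<union> Y ` {k. k mod 3 \<noteq> 0 \<and> k div 3 < j}"
          and e = "\<lambda>v. case v of X i \<Rightarrow> j | Y k \<Rightarrow> k div 3"
          and s = "\<lambda>v. case v of X i \<Rightarrow> if i = 1 then 1 else - 1 | Y k \<Rightarrow> if k mod 3 = 1 then 1 else - 1"
          and S = "insert (X 1) (Y ` (\<lambda>i. 3 * i + 1) ` {..<j})"])
  let ?e = "\<lambda>v. case v of X i \<Rightarrow> j | Y k \<Rightarrow> k div 3"
  let ?M = "{X 1, X 2} \<union> Y ` {k. k mod 3 \<noteq> 0 \<and> k div 3 < j}"
  let ?s = "\<lambda>v. case v of X i \<Rightarrow> if i = 1 then 1 else - 1 | Y k \<Rightarrow> if k mod 3 = 1 then 1 else - (1 :: 'k)"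
  have bound: "1 \<le> k \<and> k \<le> n" if "k mod 3 \<noteq> 0" "k div 3 < j" for k
    using that n by presburger
  have "X 1 \<in> lollipop_vertices m n" "X 2 \<in> lollipop_vertices m n"
    using m by (auto simp: lollipop_vertices_def)
  moreover have "Y k \<in> lollipop_vertices m n" if "k mod 3 \<noteq> 0" "k div 3 < j" for k
    using bound[OF that] by (simp add: lollipop_vertices_def)
  ultimately have M: "?M \<subseteq> lollipop_vertices m n" by blast
  have "{k. k mod 3 \<noteq> 0 \<and> k div 3 < j} \<subseteq> {..n}" using bound by auto
  then have "finite {k. k mod 3 \<noteq> 0 \<and> k div 3 < j}" by (rule finite_subset) simp
  then show "finite ?M" by simp
  show "?e v \<le> j" if "v \<in> ?M" for v using that by auto
  show "S \<in> lollipop_faces m n" if S: "S \<subseteq> ?M" "inj_on ?e S" for S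
    unfolding lollipop_faces_iff
  proof (intro conjI allI impI)
    show "S \<subseteq> lollipop_vertices m n" using S(1) M by blast
    show "i = i'" if "X i \<in> S" "X i' \<in> S" for i i' using inj_onD[OF S(2) _ that] by simp
    show "\<not> (X m \<in> S \<and> Y 1 \<in> S)" using S(1) m by auto
    show "Y (Suc k) \<notin> S" if "Y k \<in> S" for k
    proof
      assume "Y (Suc k) \<in> S"
      then have "k div 3 \<noteq> Suc k div 3" "k mod 3 \<noteq> 0" "Suc k mod 3 \<noteq> 0"
        using S that inj_onD[OF S(2), of "Y k" "Y (Suc k)"] by auto
      then show False by presburger
    qed
  qed
  show "(\<Sum>v\<in>{v\<in>?M. ?e v = i}. ?s v) = 0" if "i \<le> j" for i
  proof (cases "i = j")
    case True
    then have "{v\<in>?M. ?e v = i} = {X 1, X 2}" by auto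
    then show ?thesis by simp
  next
    case False
    then have "{v\<in>?M. ?e v = i} = Y ` {k. k mod 3 \<noteq> 0 \<and> k div 3 = i}" using that by auto
    moreover have "inj_on Y {k. k mod 3 \<noteq> 0 \<and> k div 3 = i}" by (auto simp: inj_on_def)
    ultimately show ?thesis using sum_mod3_pair[of i] by (simp add: sum.reindex)
  qed
  show "insert (X 1) (Y ` (\<lambda>i. 3 * i + 1) ` {..<j}) \<subseteq> ?M" by auto
  have "inj_on (\<lambda>i. Y (3 * i + 1)) {..<j}" by (auto simp: inj_on_def)
  then show "card (insert (X 1) (Y ` (\<lambda>i. 3 * i + 1) ` {..<j})) = Suc j"
    by (subst card_insert_disjoint) (auto simp: card_image image_image)
  show "inj_on ?e (insert (X 1) (Y ` (\<lambda>i. 3 * i + 1) ` {..<j}))" by (auto simp: inj_on_def)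
  show "?s v \<noteq> 0" for v by (cases v) simp_all
qed

section \<open>Square-free monomials\<close>

abbreviation lookup where "lookup \<equiv> Poly_Mapping.lookup"
abbreviation keys where "keys \<equiv> Poly_Mapping.keys"
abbreviation single where "single \<equiv> Poly_Mapping.single"

definition squarefree_monom :: "'v set \<Rightarrow> 'v \<Rightarrow>\<^sub>0 nat" where
  "squarefree_monom S = (\<Sum>v\<in>S. single v 1)"

lemma lookup_squarefree_monom:
  "finite S \<Longrightarrow> lookup (squarefree_monom S) v = (if v \<in> S then 1 else 0)"
  unfolding squarefree_monom_def lookup_sum
  by (simp add: lookup_single when_def)

lemma keys_squarefree_monom: "finite S \<Longrightarrow> keys (squarefree_monom S) = S"
  by (auto simp: in_keys_iff lookup_squarefree_monom split: if_splits)

lemma monom_degree_squarefree_monom: "finite S \<Longrightarrow> monom_degree (squarefree_monom S) = card S"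
  by (simp add: monom_degree_def keys_squarefree_monom lookup_squarefree_monom)

lemma squarefree_monom_eq_iff:
  "finite S \<Longrightarrow> finite T \<Longrightarrow> squarefree_monom S = squarefree_monom T \<longleftrightarrow> S = T"
  by (metis keys_squarefree_monom)

lemma squarefree_monom_remove:
  "finite T \<Longrightarrow> v \<in> T \<Longrightarrow> squarefree_monom T = single v 1 + squarefree_monom (T - {v})"
  unfolding squarefree_monom_def by (rule sum.remove)

lemma monom_degree_add: "monom_degree (s + t) = monom_degree s + monom_degree t"
proof -
  have extend: "monom_degree u = (\<Sum>v\<in>keys s \<union> keys t. lookup u v)"
    if "keys u \<subseteq> keys s \<union> keys t" for u
    unfolding monom_degree_def using that by (intro sum.mono_neutral_left) (auto simp: in_keys_iff)
  show ?thesis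
    using Poly_Mapping.keys_add[of s t] by (simp add: extend lookup_add sum.distrib)
qed

lemma monom_degree_eq_1E:
  assumes "monom_degree t = 1"
  obtains v where "t = single v 1"
proof -
  obtain v where v: "v \<in> keys t" "lookup t v = 1" "\<And>w. w \<in> keys t \<Longrightarrow> v \<noteq> w \<Longrightarrow> lookup t w = 0"
    using assms unfolding monom_degree_def by (auto simp: sum_eq_Suc0_iff)
  have "t = single v 1"
  proof (rule poly_mapping_eqI)
    fix w show "lookup t w = lookup (single v 1) w"
      using v(2) v(3)[of w] by (cases "w \<in> keys t") (auto simp: lookup_single when_def in_keys_iff)
  qed
  then show thesis by (rule that)
qed

lemma poly_mapping_sum_single: "(\<Sum>t\<in>keys p. single t (lookup p t)) = p"
  by (rule poly_mapping_eqI)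
    (simp add: lookup_sum lookup_single when_def in_keys_iff)

lemma lookup_single_times:
  fixes t s :: "'v \<Rightarrow>\<^sub>0 nat"
  shows "lookup (single t c * p) (t + s) = c * lookup p s"
  by (simp add: lookup_mult lookup_single when_mult)

lemma lookup_single_times_eq_0:
  assumes "\<And>s. u \<noteq> t + s"
  shows "lookup (single t c * p) u = 0"
proof -
  have "u \<notin> keys (single t c * p)"
    using keys_mult[of "single t c" p] assms by (auto split: if_splits)
  then show ?thesis by (simp add: in_keys_iff)
qed

lemma lookup_linear_times_squarefree:
  fixes p l :: "('v, 'k::comm_ring_1) mpoly"
  assumes l: "homogeneous 1 l" and T: "finite T"
  shows "lookup (l * p) (squarefree_monom T) =
         (\<Sum>v\<in>T. lookup l (single v 1) * lookup p (squarefree_monom (T - {v})))"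
proof -
  let ?term = "\<lambda>t. lookup (single t (lookup l t) * p) (squarefree_monom T)"
  have "lookup (l * p) (squarefree_monom T) = (\<Sum>t\<in>keys l. ?term t)"
    by (subst (1) poly_mapping_sum_single[of l, symmetric]) (simp add: sum_distrib_right lookup_sum)
  also have "\<dots> = (\<Sum>t\<in>(\<lambda>v. single v 1) ` T. ?term t)"
  proof (rule sum.mono_neutral_cong)
    fix t assume t: "t \<in> keys l - (\<lambda>v. single v 1) ` T"
    then have "int (monom_degree t) = 1" using l by (auto simp: homogeneous_def)
    then obtain v where v: "t = single v 1" using monom_degree_eq_1E[of t] by auto
    then have "v \<notin> T" using t by auto
    have "squarefree_monom T \<noteq> t + s" for s
    proof
      assume "squarefree_monom T = t + s"
      then have "lookup (squarefree_monom T) v = lookup (t + s) v" by simp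
      then show False using \<open>v \<notin> T\<close> T by (simp add: v lookup_add lookup_squarefree_monom)
    qed
    then show "?term t = 0" by (rule lookup_single_times_eq_0)
  qed (use T in \<open>auto simp: in_keys_iff\<close>)
  also have "\<dots> = (\<Sum>v\<in>T. ?term (single v 1))"
    by (subst sum.reindex) (auto simp: inj_on_def dest: arg_cong[where f = keys])
  also have "\<dots> = (\<Sum>v\<in>T. lookup l (single v 1) * lookup p (squarefree_monom (T - {v})))"
    using T by (intro sum.cong) (auto simp: squarefree_monom_remove lookup_single_times)
  finally show ?thesis .
qed

section \<open>The relations of the graph algebra\<close>

lemma carrier_poly_ring: "p \<in> carrier (poly_ring V) \<longleftrightarrow> (\<forall>t\<in>keys p. keys t \<subseteq> V)"
  by (simp add: poly_ring_def)

lemma poly_ring_simps [simp]: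
  "\<zero>\<^bsub>poly_ring V\<^esub> = 0" "\<one>\<^bsub>poly_ring V\<^esub> = 1" "p \<oplus>\<^bsub>poly_ring V\<^esub> q = p + q" "p \<otimes>\<^bsub>poly_ring V\<^esub> q = p * q"
  by (simp_all add: poly_ring_def)

lemma uminus_carrier_poly_ring: "p \<in> carrier (poly_ring V) \<Longrightarrow> - p \<in> carrier (poly_ring V)"
  by (simp add: carrier_poly_ring)

lemma a_inv_poly_ring:
  fixes p :: "('v, 'k::comm_ring_1) mpoly"
  assumes "p \<in> carrier (poly_ring V)"
  shows "\<ominus>\<^bsub>poly_ring V\<^esub> p = - p"
proof -
  interpret cring "poly_ring V :: ('v, 'k) mpoly ring" by (rule cring_poly_ring)
  show ?thesis using assms uminus_carrier_poly_ring[OF assms] by (intro minus_equality) auto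
qed

text \<open>The explicit form of the ideal of relations: no monomial of an independent set occurs.\<close>

definition vanishing_on_independent :: "'v set \<Rightarrow> 'v set set \<Rightarrow> ('v, 'k::comm_ring_1) mpoly set" where
  "vanishing_on_independent V E =
     {p \<in> carrier (poly_ring V). \<forall>S\<in>independent_sets V E. lookup p (squarefree_monom S) = 0}"

text \<open>Any factor of the monomial of an independent set is again the monomial of an independent set.\<close>

lemma ideal_vanishing_on_independent:
  assumes "finite V"
  shows "ideal (vanishing_on_independent V E) (poly_ring V :: ('v, 'k::comm_ring_1) mpoly ring)"
proof -
  interpret cring "poly_ring V :: ('v, 'k) mpoly ring" by (rule cring_poly_ring)
  let ?J = "vanishing_on_independent V E :: ('v, 'k) mpoly set"
  note \<Delta> = simplicial_complexD[OF simplicial_complex_independent_sets[OF assms]]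
  have mult: "q * p \<in> ?J" if p: "p \<in> ?J" and q: "q \<in> carrier (poly_ring V)" for p q
  proof -
    have "squarefree_monom S \<notin> keys (q * p)" if S: "S \<in> independent_sets V E" for S
    proof
      assume "squarefree_monom S \<in> keys (q * p)"
      then obtain a b where ab: "squarefree_monom S = a + b" "b \<in> keys p"
        using keys_mult[of q p] by blast
      have le: "lookup b v \<le> (if v \<in> S then 1 else 0)" for v
        using arg_cong[OF ab(1), of "\<lambda>t. lookup t v"] \<Delta>(2)[OF S]
        by (simp add: lookup_add lookup_squarefree_monom split: if_splits)
      then have sub: "keys b \<subseteq> S" by (force simp: in_keys_iff split: if_splits)
      have "b = squarefree_monom (keys b)"
      proof (rule poly_mapping_eqI)
        fix v show "lookup b v = lookup (squarefree_monom (keys b)) v"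
          using le[of v] by (auto simp: lookup_squarefree_monom in_keys_iff split: if_splits)
      qed
      moreover have "lookup p (squarefree_monom (keys b)) = 0"
        using p \<Delta>(3)[OF S sub] by (simp add: vanishing_on_independent_def)
      ultimately show False using ab(2) by (simp add: in_keys_iff)
    qed
    then show ?thesis
      using p q m_closed[of q p] by (auto simp: vanishing_on_independent_def in_keys_iff)
  qed
  show ?thesis
  proof (rule idealI)
    show "ring (poly_ring V :: ('v, 'k) mpoly ring)" by (rule ring_axioms)
    show "subgroup ?J (add_monoid (poly_ring V))"
    proof (rule add.subgroupI)
      show "?J \<noteq> {}" using zero_closed by (auto simp: vanishing_on_independent_def)
      show "\<ominus>\<^bsub>poly_ring V\<^esub> p \<in> ?J" if "p \<in> ?J" for p
        using that by (auto simp: vanishing_on_independent_def a_inv_poly_ring uminus_carrier_poly_ring)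
      show "p \<oplus>\<^bsub>poly_ring V\<^esub> q \<in> ?J" if "p \<in> ?J" "q \<in> ?J" for p q
        using that a_closed[of p q] by (auto simp: vanishing_on_independent_def lookup_add)
    qed (auto simp: vanishing_on_independent_def)
  qed (use mult in \<open>auto simp: mult.commute\<close>)
qed

lemma single_in_ideal_if_dvd:
  fixes I :: "('v, 'k::comm_ring_1) mpoly set"
  assumes I: "ideal I (poly_ring V)" and g: "single s 1 \<in> I" and t: "t = s + u" and V: "keys t \<subseteq> V"
  shows "single t c \<in> I"
proof -
  have "keys u \<subseteq> keys t" by (auto simp: t in_keys_iff lookup_add)
  then have "single u c \<in> carrier (poly_ring V)" using V by (auto simp: carrier_poly_ring)
  from ideal.I_r_closed[OF I g this] show ?thesis by (simp add: mult_single t)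
qed

lemma var_times_var: "var u * var v = single (single u 1 + single v 1) 1"
  by (simp add: var_def mult_single)

lemma var_in_carrier: "v \<in> V \<Longrightarrow> var v \<in> carrier (poly_ring V)"
  by (simp add: var_def carrier_poly_ring)

lemma graph_relations_ideal:
  assumes E: "\<Union>E \<subseteq> V"
  shows "ideal (graph_relations V E) (poly_ring V :: ('v, 'k::comm_ring_1) mpoly ring)"
    and "v \<in> V \<Longrightarrow> var v ^ 2 \<in> (graph_relations V E :: ('v, 'k) mpoly set)"
    and "{u, v} \<in> E \<Longrightarrow> var u * var v \<in> (graph_relations V E :: ('v, 'k) mpoly set)"
    and "finite V \<Longrightarrow> graph_relations V E \<subseteq> (vanishing_on_independent V E :: ('v, 'k) mpoly set)"
proof -
  interpret cring "poly_ring V :: ('v, 'k) mpoly ring" by (rule cring_poly_ring)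
  let ?sq = "{var v ^ 2 | v. v \<in> V} :: ('v, 'k) mpoly set"
  let ?ed = "{var u * var v | u v. {u, v} \<in> E} :: ('v, 'k) mpoly set"
  have sq: "?sq \<subseteq> carrier (poly_ring V)" and ed: "?ed \<subseteq> carrier (poly_ring V)"
    using m_closed[OF var_in_carrier var_in_carrier] E by (auto simp: power2_eq_square)
  note ids = genideal_ideal[OF sq] genideal_ideal[OF ed]
  have I: "graph_relations V E = Idl\<^bsub>poly_ring V\<^esub> ?sq <+>\<^bsub>poly_ring V\<^esub> Idl\<^bsub>poly_ring V\<^esub> ?ed"
    by (simp add: graph_relations_def edge_ideal_def)
  show "ideal (graph_relations V E) (poly_ring V :: ('v, 'k) mpoly ring)"
    unfolding I by (rule add_ideals[OF ids])
  have zero: "0 \<in> Idl\<^bsub>poly_ring V\<^esub> ?sq" "0 \<in> Idl\<^bsub>poly_ring V\<^esub> ?ed"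
    using ids[THEN ideal.axioms(1), THEN additive_subgroup.zero_closed] by simp_all
  have sum: "a + b \<in> graph_relations V E"
    if "a \<in> Idl\<^bsub>poly_ring V\<^esub> ?sq" "b \<in> Idl\<^bsub>poly_ring V\<^esub> ?ed" for a b
    using that unfolding I set_add_def' by force
  show "var v ^ 2 \<in> (graph_relations V E :: ('v, 'k) mpoly set)" if "v \<in> V"
    using sum[OF _ zero(2)] genideal_self[OF sq] that by auto
  show "var u * var v \<in> (graph_relations V E :: ('v, 'k) mpoly set)" if "{u, v} \<in> E"
    using sum[OF zero(1)] genideal_self[OF ed] that by auto
  show "graph_relations V E \<subseteq> (vanishing_on_independent V E :: ('v, 'k) mpoly set)" if fin: "finite V"
  proof -
    let ?J = "vanishing_on_independent V E :: ('v, 'k) mpoly set"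
    note J = ideal_vanishing_on_independent[OF fin, of E, where 'k = 'k]
    note \<Delta> = simplicial_complexD[OF simplicial_complex_independent_sets[OF fin]]
    have quad: "var u * var v \<in> ?J" if uv: "u \<in> V" "v \<in> V" "u = v \<or> {u, v} \<in> E" for u v
    proof -
      have "squarefree_monom S \<noteq> single u 1 + single v 1" if S: "S \<in> independent_sets V E" for S
      proof
        assume eq: "squarefree_monom S = single u 1 + single v 1"
        have "lookup (squarefree_monom S) w = (if w = u then 1 else 0) + (if w = v then 1 else 0)" for w
          unfolding eq by (simp add: lookup_add lookup_single when_def)
        from this[of u] this[of v] show False
          using \<Delta>(2)[OF S] S uv(3) by (auto simp: lookup_squarefree_monom independent_sets_def split: if_splits)
      qed
      then have "lookup (var u * var v :: ('v, 'k) mpoly) (squarefree_monom S) = 0"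
        if "S \<in> independent_sets V E" for S
        unfolding var_times_var using that by (metis lookup_single_not_eq)
      then show ?thesis
        using m_closed[OF var_in_carrier[OF uv(1)] var_in_carrier[OF uv(2)]]
        by (simp add: vanishing_on_independent_def)
    qed
    have "Idl\<^bsub>poly_ring V\<^esub> ?sq \<subseteq> ?J"
      by (rule genideal_minimal[OF J]) (auto simp: power2_eq_square quad)
    moreover have "Idl\<^bsub>poly_ring V\<^esub> ?ed \<subseteq> ?J"
      by (rule genideal_minimal[OF J]) (use E in \<open>auto intro!: quad\<close>)
    moreover have "a + b \<in> ?J" if "a \<in> ?J" "b \<in> ?J" for a b
      using additive_subgroup.a_closed[OF ideal.axioms(1)[OF J] that] by simp
    ultimately show ?thesis unfolding I set_add_def' by auto
  qed
qed

text \<open>A monomial that does not belong to an independent set is divisible by a square of a variable or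
  by the product of the two ends of an edge.\<close>

lemma graph_relations_eq:
  assumes fin: "finite V" and E: "\<Union>E \<subseteq> V"
  shows "graph_relations V E = (vanishing_on_independent V E :: ('v, 'k::comm_ring_1) mpoly set)"
proof
  note rel = graph_relations_ideal[OF E, where 'k = 'k]
  note add_subgroup = ideal.axioms(1)[OF rel(1)]
  show "graph_relations V E \<subseteq> (vanishing_on_independent V E :: ('v, 'k) mpoly set)"
    using rel(4)[OF fin] by blast
  show "vanishing_on_independent V E \<subseteq> (graph_relations V E :: ('v, 'k) mpoly set)"
  proof
    fix p :: "('v, 'k) mpoly"
    assume p: "p \<in> vanishing_on_independent V E"
    have mem: "single t c \<in> (graph_relations V E :: ('v, 'k) mpoly set)" if t: "t \<in> keys p" for t c
    proof -
      have tV: "keys t \<subseteq> V" using p t by (auto simp: vanishing_on_independent_def carrier_poly_ring)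
      show ?thesis
      proof (cases "\<exists>v. lookup t v \<ge> 2")
        case True
        then obtain v where v: "lookup t v \<ge> 2" by blast
        then have "v \<in> V" using tV by (force simp: in_keys_iff)
        then have "single (single v 1 + single v 1) 1 \<in> (graph_relations V E :: ('v, 'k) mpoly set)"
          using rel(2) by (simp add: power2_eq_square var_times_var)
        moreover have "t = (single v 1 + single v 1) + (t - (single v 1 + single v 1))"
          by (rule poly_mapping_eqI) (use v in \<open>auto simp: lookup_add lookup_minus lookup_single when_def\<close>)
        ultimately show ?thesis using single_in_ideal_if_dvd[OF rel(1) _ _ tV] by blast
      next
        case False
        have "t = squarefree_monom (keys t)"
        proof (rule poly_mapping_eqI)
          fix v show "lookup t v = lookup (squarefree_monom (keys t)) v"
            using False[simplified, rule_format, of v] by (auto simp: lookup_squarefree_monom in_keys_iff)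
        qed
        then have "keys t \<notin> independent_sets V E"
          using p t by (auto simp: vanishing_on_independent_def in_keys_iff)
        then obtain u v where uv: "u \<in> keys t" "v \<in> keys t" "u \<noteq> v" "{u, v} \<in> E"
          using tV by (auto simp: independent_sets_def)
        have "single (single u 1 + single v 1) 1 \<in> (graph_relations V E :: ('v, 'k) mpoly set)"
          using rel(3)[OF uv(4)] by (simp add: var_times_var)
        moreover have "t = (single u 1 + single v 1) + (t - (single u 1 + single v 1))"
          by (rule poly_mapping_eqI)
            (use uv in \<open>auto simp: lookup_add lookup_minus lookup_single when_def in_keys_iff\<close>)
        ultimately show ?thesis using single_in_ideal_if_dvd[OF rel(1) _ _ tV] by blast
      qed
    qed
    have "(\<Sum>t\<in>A. single t (lookup p t)) \<in> (graph_relations V E :: ('v, 'k) mpoly set)"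
      if "finite A" "A \<subseteq> keys p" for A
      using that
    proof (induction A rule: finite_induct)
      case empty
      then show ?case using additive_subgroup.zero_closed[OF add_subgroup] by simp
    next
      case (insert t A)
      then show ?case using additive_subgroup.a_closed[OF add_subgroup mem[of t "lookup p t"]] by simp
    qed
    from this[of "keys p"] show "p \<in> graph_relations V E" by (simp add: poly_mapping_sum_single)
  qed
qed

section \<open>The weak Lefschetz property in terms of the independence complex\<close>

definition layer_poly :: "'v set set \<Rightarrow> nat \<Rightarrow> ('v set \<Rightarrow> 'k) \<Rightarrow> ('v, 'k::comm_ring_1) mpoly" where
  "layer_poly \<Delta> j f = (\<Sum>S\<in>{S\<in>\<Delta>. card S = j}. single (squarefree_monom S) (f S))"

lemma layer_poly:
  fixes f :: "'v set \<Rightarrow> 'k::comm_ring_1"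
  assumes "finite V"
  shows "S \<in> independent_sets V E \<Longrightarrow>
           lookup (layer_poly (independent_sets V E) j f) (squarefree_monom S) = (if card S = j then f S else 0)"
    and "layer_poly (independent_sets V E) j f \<in> carrier (poly_ring V)"
    and "homogeneous (int j) (layer_poly (independent_sets V E) j f)"
proof -
  note \<Delta> = simplicial_complexD[OF simplicial_complex_independent_sets[OF assms, of E]]
  let ?p = "layer_poly (independent_sets V E) j f"
  show "lookup ?p (squarefree_monom S) = (if card S = j then f S else 0)" if "S \<in> independent_sets V E"
  proof -
    have "lookup ?p (squarefree_monom S) =
        (\<Sum>T\<in>{T\<in>independent_sets V E. card T = j}. if T = S then f T else 0)"
      unfolding layer_poly_def lookup_sum using \<Delta>(2) that
      by (intro sum.cong) (auto simp: lookup_single when_def squarefree_monom_eq_iff)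
    then show ?thesis using \<Delta>(1) that by simp
  qed
  have "keys ?p \<subseteq> (\<Union>S\<in>{S\<in>independent_sets V E. card S = j}. keys (single (squarefree_monom S) (f S)))"
    unfolding layer_poly_def by (rule keys_sum)
  then have keys: "\<exists>S\<in>independent_sets V E. card S = j \<and> t = squarefree_monom S" if "t \<in> keys ?p" for t
    using that by (fastforce split: if_splits)
  show "?p \<in> carrier (poly_ring V)"
    using keys \<Delta>(2) by (fastforce simp: carrier_poly_ring keys_squarefree_monom independent_sets_def)
  show "homogeneous (int j) ?p"
    using keys \<Delta>(2) by (fastforce simp: homogeneous_def monom_degree_squarefree_monom)
qed

lemma homogeneous_lookup_eq_0:
  assumes "homogeneous j p" "finite S" "int (card S) \<noteq> j"
  shows "lookup p (squarefree_monom S) = 0"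
  using assms unfolding homogeneous_def by (metis in_keys_iff monom_degree_squarefree_monom)

lemma homogeneous_mult:
  assumes "homogeneous i p" "homogeneous j q"
  shows "homogeneous (i + j) (p * q)"
  unfolding homogeneous_def
proof
  fix t assume "t \<in> keys (p * q)"
  then obtain a b where "t = a + b" "a \<in> keys p" "b \<in> keys q" using keys_mult[of p q] by blast
  then show "int (monom_degree t) = i + j"
    using assms by (auto simp: homogeneous_def monom_degree_add)
qed

lemma homogeneous_0: "homogeneous j 0"
  by (simp add: homogeneous_def)

lemma coset_eq_iff:
  fixes p q :: "('v, 'k::comm_ring_1) mpoly"
  assumes fin: "finite V" and E: "\<Union>E \<subseteq> V"
    and p: "p \<in> carrier (poly_ring V)" and q: "q \<in> carrier (poly_ring V)"
  shows "graph_relations V E +>\<^bsub>poly_ring V\<^esub> p = graph_relations V E +>\<^bsub>poly_ring V\<^esub> q \<longleftrightarrow>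
         (\<forall>S\<in>independent_sets V E. lookup p (squarefree_monom S) = lookup q (squarefree_monom S))"
proof -
  interpret cring "poly_ring V :: ('v, 'k) mpoly ring" by (rule cring_poly_ring)
  have "p \<ominus>\<^bsub>poly_ring V\<^esub> q = p - q"
    using q by (simp add: a_minus_def a_inv_poly_ring)
  moreover have "p - q \<in> carrier (poly_ring V)"
    using a_closed[OF p uminus_carrier_poly_ring[OF q]] by simp
  ultimately show ?thesis
    using quotient_eq_iff_same_a_r_cos[OF graph_relations_ideal(1)[OF E] p q]
    by (simp add: graph_relations_eq[OF fin E] vanishing_on_independent_def lookup_minus)
qed

lemma coset_mult:
  fixes p q :: "('v, 'k::comm_ring_1) mpoly"
  assumes E: "\<Union>E \<subseteq> V"
    and p: "p \<in> carrier (poly_ring V)" and q: "q \<in> carrier (poly_ring V)"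
  shows "(graph_relations V E +>\<^bsub>poly_ring V\<^esub> p) \<otimes>\<^bsub>graph_algebra V E\<^esub> (graph_relations V E +>\<^bsub>poly_ring V\<^esub> q) =
         graph_relations V E +>\<^bsub>poly_ring V\<^esub> (p * q)"
  using ideal.rcoset_mult_add[OF graph_relations_ideal(1)[OF E] p q]
  by (simp add: graph_algebra_def FactRing_def)

text \<open>A homogeneous class is determined by its coefficients at the independent sets of its degree, and
  all coefficients occur, so the multiplication maps between components translate literally.
  The components of negative degree are zero and satisfy the condition for free.\<close>

lemma weak_lefschetz_graph_algebra_iff:
  assumes fin: "finite V" and E: "\<Union>E \<subseteq> V"
  shows "weak_lefschetz (graph_algebra V E :: ('v, 'k::field) mpoly set ring) (graph_algebra_component V E) \<longleftrightarrow>
         (\<exists>a :: 'v \<Rightarrow> 'k. \<forall>j. ker_trivial a (independent_sets V E) j \<or> mult_surjective a (independent_sets V E) j)"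
proof -
  interpret cring "poly_ring V :: ('v, 'k) mpoly ring" by (rule cring_poly_ring)
  let ?\<Delta> = "independent_sets V E"
  let ?A = "graph_algebra V E :: ('v, 'k) mpoly set ring"
  let ?gr = "graph_algebra_component V E :: int \<Rightarrow> ('v, 'k) mpoly set set"
  let ?homog = "\<lambda>j. {p :: ('v, 'k) mpoly. p \<in> carrier (poly_ring V) \<and> homogeneous j p}"
  define cls where "cls p = graph_relations V E +>\<^bsub>poly_ring V\<^esub> p" for p :: "('v, 'k) mpoly"
  define co where "co p S = lookup p (squarefree_monom S)" for p :: "('v, 'k) mpoly" and S
  note \<Delta> = simplicial_complexD[OF simplicial_complex_independent_sets[OF fin, of E]]
  have gr: "?gr j = cls ` ?homog j" for j
    by (auto simp: graph_algebra_component_def cls_def)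
  have cls_eq: "cls p = cls q \<longleftrightarrow> (\<forall>S\<in>?\<Delta>. co p S = co q S)"
    if "p \<in> carrier (poly_ring V)" "q \<in> carrier (poly_ring V)" for p q
    using coset_eq_iff[OF fin E that] by (simp add: cls_def co_def)
  have co_0: "co p S = 0" if "homogeneous j p" "S \<in> ?\<Delta>" "int (card S) \<noteq> j" for p S j
    using homogeneous_lookup_eq_0[OF that(1) \<Delta>(2)[OF that(2)] that(3)] by (simp add: co_def)
  have co_layer: "co (layer_poly ?\<Delta> j f) S = (if card S = j then f S else 0)" if "S \<in> ?\<Delta>" for j f S
    by (simp add: co_def layer_poly(1)[OF fin that])
  have layer: "layer_poly ?\<Delta> j f \<in> ?homog (int j)" for j f
    using layer_poly(2,3)[OF fin] by auto
  \<comment> \<open>Multiplication by the linear form with coefficients \<open>a\<close>, read off in terms of coefficients.\<close>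
  have degreewise:
    "inj_on (\<lambda>x. cls l \<otimes>\<^bsub>?A\<^esub> x) (?gr (int j)) \<longleftrightarrow> ker_trivial a ?\<Delta> j" (is ?inj)
    "(\<lambda>x. cls l \<otimes>\<^bsub>?A\<^esub> x) ` ?gr (int j) = ?gr (int j + 1) \<longleftrightarrow> mult_surjective a ?\<Delta> j" (is ?surj)
    if l: "l \<in> ?homog 1" and a: "\<And>v. v \<in> V \<Longrightarrow> lookup l (single v 1) = a v" for l a j
  proof -
    have lc: "l \<in> carrier (poly_ring V)" "homogeneous 1 l" using l by auto
    have mult: "cls l \<otimes>\<^bsub>?A\<^esub> cls p = cls (l * p)" if "p \<in> carrier (poly_ring V)" for p
      using coset_mult[OF E lc(1) that] by (simp add: cls_def)
    have lp: "l * p \<in> ?homog (int j + 1)" if "p \<in> ?homog (int j)" for p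
      using that lc m_closed[of l p] homogeneous_mult[OF lc(2), of "int j" p] by (simp add: add.commute)
    have co_l: "co (l * p) T = (\<Sum>v\<in>T. a v * co p (T - {v}))" if "T \<in> ?\<Delta>" for p T
    proof -
      have "T \<subseteq> V" using that by (auto simp: independent_sets_def)
      then show ?thesis
        unfolding co_def lookup_linear_times_squarefree[OF lc(2) \<Delta>(2)[OF that]]
        using a by (intro sum.cong) auto
    qed
    have co_top: "co q T = co q' T"
      if "q \<in> ?homog (int j + 1)" "q' \<in> ?homog (int j + 1)" "T \<in> ?\<Delta>" "card T \<noteq> Suc j" for q q' T
      using that co_0[of "int j + 1" _ T] by simp
    show ?inj
    proof
      assume inj: "inj_on (\<lambda>x. cls l \<otimes>\<^bsub>?A\<^esub> x) (?gr (int j))"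
      show "ker_trivial a ?\<Delta> j"
        unfolding ker_trivial_def
      proof (intro allI impI ballI)
        fix f :: "'v set \<Rightarrow> 'k" and S
        assume f: "\<forall>T\<in>?\<Delta>. card T = Suc j \<longrightarrow> (\<Sum>v\<in>T. a v * f (T - {v})) = 0"
          and S: "S \<in> ?\<Delta>" "card S = j"
        let ?p = "layer_poly ?\<Delta> j f"
        have zero: "0 \<in> ?homog i" for i using zero_closed by (simp add: homogeneous_0)
        have "co (l * ?p) T = co (l * 0) T" if T: "T \<in> ?\<Delta>" for T
        proof (cases "card T = Suc j")
          case True
          have "co (l * ?p) T = (\<Sum>v\<in>T. a v * f (T - {v}))"
            unfolding co_l[OF T] using True \<Delta>(2)[OF T] \<Delta>(3)[OF T]
            by (intro sum.cong) (auto simp: co_layer)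
          then show ?thesis using f T True by (simp add: co_def)
        next
          case False
          then show ?thesis using co_top[OF lp[OF layer] lp[OF zero] T] by simp
        qed
        then have "cls l \<otimes>\<^bsub>?A\<^esub> cls ?p = cls l \<otimes>\<^bsub>?A\<^esub> cls 0"
          using lp[OF layer, of f] lp[OF zero] layer[of j f] zero by (simp add: mult cls_eq)
        then have "cls ?p = cls 0"
          using inj_onD[OF inj, of "cls ?p" "cls 0"] layer[of j f] zero by (auto simp: gr)
        then have "co ?p S = co 0 S" using layer[of j f] zero S(1) by (simp add: cls_eq)
        then show "f S = 0" using co_layer[OF S(1), of j f] S(2) by (simp add: co_def)
      qed
    next
      assume ker: "ker_trivial a ?\<Delta> j"
      show "inj_on (\<lambda>x. cls l \<otimes>\<^bsub>?A\<^esub> x) (?gr (int j))"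
      proof (rule inj_onI)
        fix x y assume xy: "x \<in> ?gr (int j)" "y \<in> ?gr (int j)" "cls l \<otimes>\<^bsub>?A\<^esub> x = cls l \<otimes>\<^bsub>?A\<^esub> y"
        then obtain p q where pq: "x = cls p" "y = cls q" "p \<in> ?homog (int j)" "q \<in> ?homog (int j)"
          unfolding gr by blast
        have "co (l * p) T = co (l * q) T" if "T \<in> ?\<Delta>" for T
          using xy(3) pq lp[OF pq(3)] lp[OF pq(4)] that by (simp add: mult cls_eq)
        then have "(\<Sum>v\<in>T. a v * (co p (T - {v}) - co q (T - {v}))) = 0" if "T \<in> ?\<Delta>" for T
          using that by (simp add: co_l right_diff_distrib sum_subtractf)
        then have "co p S - co q S = 0" if "S \<in> ?\<Delta>" "card S = j" for S
          using ker[unfolded ker_trivial_def, THEN spec[of _ "\<lambda>S. co p S - co q S"]] that by blast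
        moreover have "co p S = co q S" if "S \<in> ?\<Delta>" "card S \<noteq> j" for S
          using that pq co_0[of "int j" _ S] by simp
        ultimately show "x = y" using pq by (auto simp: cls_eq)
      qed
    qed
    show ?surj
    proof
      assume surj: "(\<lambda>x. cls l \<otimes>\<^bsub>?A\<^esub> x) ` ?gr (int j) = ?gr (int j + 1)"
      show "mult_surjective a ?\<Delta> j"
        unfolding mult_surjective_def
      proof
        fix g :: "'v set \<Rightarrow> 'k"
        let ?q = "layer_poly ?\<Delta> (Suc j) g"
        have q: "?q \<in> ?homog (int j + 1)" using layer[of "Suc j" g] by (simp add: add.commute)
        then have "cls ?q \<in> (\<lambda>x. cls l \<otimes>\<^bsub>?A\<^esub> x) ` cls ` ?homog (int j)"
          using surj unfolding gr by blast
        then obtain p where p: "p \<in> ?homog (int j)" "cls ?q = cls l \<otimes>\<^bsub>?A\<^esub> cls p" by blast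
        then have "co (l * p) T = co ?q T" if "T \<in> ?\<Delta>" for T
          using that q lp[OF p(1)] by (simp add: mult cls_eq)
        then have "(\<Sum>v\<in>T. a v * co p (T - {v})) = g T" if "T \<in> ?\<Delta>" "card T = Suc j" for T
          using that by (simp add: co_l co_layer)
        then show "\<exists>f. \<forall>T\<in>?\<Delta>. card T = Suc j \<longrightarrow> (\<Sum>v\<in>T. a v * f (T - {v})) = g T" by blast
      qed
    next
      assume surj: "mult_surjective a ?\<Delta> j"
      show "(\<lambda>x. cls l \<otimes>\<^bsub>?A\<^esub> x) ` ?gr (int j) = ?gr (int j + 1)"
      proof (intro equalityI subsetI)
        fix y assume "y \<in> (\<lambda>x. cls l \<otimes>\<^bsub>?A\<^esub> x) ` ?gr (int j)"
        then obtain p where "p \<in> ?homog (int j)" "y = cls l \<otimes>\<^bsub>?A\<^esub> cls p" unfolding gr by blast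
        then show "y \<in> ?gr (int j + 1)" using lp[of p] mult[of p] unfolding gr by blast
      next
        fix y assume "y \<in> ?gr (int j + 1)"
        then obtain q where q: "q \<in> ?homog (int j + 1)" "y = cls q" unfolding gr by blast
        obtain f where f: "\<And>T. T \<in> ?\<Delta> \<Longrightarrow> card T = Suc j \<Longrightarrow> (\<Sum>v\<in>T. a v * f (T - {v})) = co q T"
          using surj[unfolded mult_surjective_def, THEN spec[of _ "co q"]] by blast
        let ?p = "layer_poly ?\<Delta> j f"
        have "co (l * ?p) T = co q T" if T: "T \<in> ?\<Delta>" for T
        proof (cases "card T = Suc j")
          case True
          have "co (l * ?p) T = (\<Sum>v\<in>T. a v * f (T - {v}))"
            unfolding co_l[OF T] using True \<Delta>(2)[OF T] \<Delta>(3)[OF T]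
            by (intro sum.cong) (auto simp: co_layer)
          then show ?thesis using f T True by simp
        next
          case False
          then show ?thesis using co_top[OF lp[OF layer] q(1) T] by simp
        qed
        then have "y = cls l \<otimes>\<^bsub>?A\<^esub> cls ?p"
          using q lp[OF layer, of f] layer[of j f] by (simp add: mult cls_eq)
        then show "y \<in> (\<lambda>x. cls l \<otimes>\<^bsub>?A\<^esub> x) ` ?gr (int j)" using layer[of j f] unfolding gr by blast
      qed
    qed
  qed
  have negative: "inj_on h (?gr j)" if "j < 0" for j and h :: "('v, 'k) mpoly set \<Rightarrow> ('v, 'k) mpoly set"
  proof -
    have "p = 0" if "homogeneous j p" for p :: "('v, 'k) mpoly"
    proof -
      have "keys p = {}" using that \<open>j < 0\<close> by (force simp: homogeneous_def)
      then show ?thesis by simp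
    qed
    then show ?thesis unfolding gr inj_on_def by blast
  qed
  show ?thesis
  proof
    assume "weak_lefschetz ?A ?gr"
    then obtain l where l: "l \<in> ?homog 1"
      and max_rank: "\<And>j. inj_on (\<lambda>x. cls l \<otimes>\<^bsub>?A\<^esub> x) (?gr j) \<or> (\<lambda>x. cls l \<otimes>\<^bsub>?A\<^esub> x) ` ?gr j = ?gr (j + 1)"
      unfolding weak_lefschetz_def gr by blast
    have "ker_trivial (\<lambda>v. lookup l (single v 1)) ?\<Delta> j \<or> mult_surjective (\<lambda>v. lookup l (single v 1)) ?\<Delta> j" for j
      using max_rank[of "int j"] degreewise[OF l refl, of j] by blast
    then show "\<exists>a :: 'v \<Rightarrow> 'k. \<forall>j. ker_trivial a ?\<Delta> j \<or> mult_surjective a ?\<Delta> j" by blast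
  next
    assume "\<exists>a :: 'v \<Rightarrow> 'k. \<forall>j. ker_trivial a ?\<Delta> j \<or> mult_surjective a ?\<Delta> j"
    then obtain a :: "'v \<Rightarrow> 'k" where a: "\<And>j. ker_trivial a ?\<Delta> j \<or> mult_surjective a ?\<Delta> j" by blast
    define l where "l = (\<Sum>v\<in>V. single (single v (1::nat)) (a v))"
    have coeff: "lookup l (single v 1) = a v" if "v \<in> V" for v
    proof -
      have eq: "single w (1::nat) = single v 1 \<longleftrightarrow> w = v" for w
        by (metis inj_single keys_single zero_neq_one singleton_inject)
      show ?thesis using fin that
        by (simp add: l_def lookup_sum lookup_single when_def eq del: One_nat_def)
    qed
    have "keys l \<subseteq> (\<Union>v\<in>V. keys (single (single v (1::nat)) (a v)))"
      unfolding l_def by (rule keys_sum)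
    then have keys_l: "\<exists>v\<in>V. t = single v 1" if "t \<in> keys l" for t
      using that by (fastforce split: if_splits)
    have "l \<in> ?homog 1"
      using keys_l by (fastforce simp: carrier_poly_ring homogeneous_def monom_degree_def)
    note deg = degreewise[OF this coeff]
    have "inj_on (\<lambda>x. cls l \<otimes>\<^bsub>?A\<^esub> x) (?gr j) \<or> (\<lambda>x. cls l \<otimes>\<^bsub>?A\<^esub> x) ` ?gr j = ?gr (j + 1)" for j
    proof (cases "j < 0")
      case False
      then obtain i where "j = int i" by (metis nonneg_int_cases not_less)
      then show ?thesis using a[of i] deg[of i] by simp
    qed (use negative in blast)
    moreover have "cls l \<in> ?gr 1" unfolding gr using \<open>l \<in> ?homog 1\<close> by blast
    ultimately show "weak_lefschetz ?A ?gr" unfolding weak_lefschetz_def by blast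
  qed
qed

section \<open>Lollipop graphs\<close>

theorem theorem1p3:
  fixes m n :: nat
  assumes "m \<ge> 1" and "n \<ge> 1"
  shows "weak_lefschetz
           (graph_algebra (lollipop_vertices m n) (lollipop_edges m n)
              :: (lollipop_vertex, 'k::field_char_0) mpoly set ring)
           (graph_algebra_component (lollipop_vertices m n) (lollipop_edges m n))
         \<longleftrightarrow>
           (m = 1 \<and> n \<in> {1, 2, 3, 4, 5, 6, 8, 9, 12}) \<or>
           (m = 2 \<and> n \<in> {1, 2, 3, 4, 5, 7, 8, 11}) \<or>
           (m \<ge> 3 \<and> n \<in> {1, 3, 4, 7})"
proof -
  let ?L = "lollipop_faces m n"
  let ?N = "n + min m 2"
  have edges: "\<Union>(lollipop_edges m n) \<subseteq> lollipop_vertices m n"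
    using assms unfolding lollipop_edges_def lollipop_vertices_def by auto
  have "weak_lefschetz
           (graph_algebra (lollipop_vertices m n) (lollipop_edges m n)
              :: (lollipop_vertex, 'k) mpoly set ring)
           (graph_algebra_component (lollipop_vertices m n) (lollipop_edges m n))
         \<longleftrightarrow> (\<exists>a :: lollipop_vertex \<Rightarrow> 'k. \<forall>j. ker_trivial a ?L j \<or> coker_trivial a ?L j)"
    unfolding weak_lefschetz_graph_algebra_iff[OF finite_lollipop_vertices edges]
      mult_surjective_iff_coker_trivial[OF simplicial_complex_lollipop] ..
  also have "\<dots> \<longleftrightarrow> (\<forall>j. ker_trivial (\<lambda>_. 1 :: 'k) ?L j \<or> coker_trivial (\<lambda>_. 1 :: 'k) ?L j)"
    using ker_trivial_imp_all_ones[OF simplicial_complex_lollipop]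
      coker_trivial_imp_all_ones[OF simplicial_complex_lollipop] by blast
  also have "\<dots> \<longleftrightarrow>
           (m = 1 \<and> n \<in> {1, 2, 3, 4, 5, 6, 8, 9, 12}) \<or>
           (m = 2 \<and> n \<in> {1, 2, 3, 4, 5, 7, 8, 11}) \<or>
           (m \<ge> 3 \<and> n \<in> {1, 3, 4, 7})" (is "_ \<longleftrightarrow> ?list")
  proof -
    have coker: "coker_trivial (\<lambda>_. 1 :: 'k) ?L j \<longleftrightarrow> (if m \<le> 2 then ?N \<le> 3 * j + 1 else n + 2 \<le> 3 * j)" for j
    proof (cases "m \<le> 2")
      case True
      then show ?thesis
        using coker_trivial_path[of ?N j] not_coker_trivial_path[of j ?N]
        unfolding coker_trivial_lollipop_iff_small[OF assms(1) True] by force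
    next
      case False
      then show ?thesis
        using coker_trivial_lollipop_large[of m n j] not_coker_trivial_lollipop_large[of m j n] by force
    qed
    have ker: "ker_trivial (\<lambda>_. 1 :: 'k) ?L j \<longleftrightarrow> ker_trivial (\<lambda>_. 1 :: 'k) (path_faces ?N) j" for j
      by (rule ker_trivial_lollipop_iff[OF assms(1)])
    show ?thesis
    proof
      assume max_rank: "\<forall>j. ker_trivial (\<lambda>_. 1 :: 'k) ?L j \<or> coker_trivial (\<lambda>_. 1 :: 'k) ?L j"
      \<comment> \<open>The smallest \<open>j\<close> with \<open>?N \<le> 4 * j\<close>, where injectivity fails.\<close>
      define j where "j = (?N + 3) div 4"
      have j: "?N \<le> 4 * j" "4 * j \<le> ?N + 3" unfolding j_def by linarith+
      have bound: "if m \<le> 2 then ?N \<le> 3 * j + 1 else n + 2 \<le> 3 * j"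
        using max_rank[THEN spec[of _ j]] not_ker_trivial_path[OF j, where 'k = 'k]
        unfolding ker coker by blast
      consider "m = 1" | "m = 2" | "m \<ge> 3" using assms(1) by linarith
      then show ?list
      proof cases
        case 1
        have "j = 0 \<or> j = 1 \<or> j = 2 \<or> j = 3 \<or> j = 4" using 1 j bound by auto
        then show ?thesis using 1 j bound assms(2) by auto
      next
        case 2
        have "j = 0 \<or> j = 1 \<or> j = 2 \<or> j = 3 \<or> j = 4" using 2 j bound by auto
        then show ?thesis using 2 j bound assms(2) by auto
      next
        case 3
        have "j = 0 \<or> j = 1 \<or> j = 2 \<or> j = 3" using 3 j bound by auto
        then show ?thesis using 3 j bound assms(2) by auto
      qed
    next
      assume list: ?list
      have "4 * j + 1 \<le> ?N \<or> (if m \<le> 2 then ?N \<le> 3 * j + 1 else n + 2 \<le> 3 * j)" for j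
      proof -
        consider "m = 1" | "m = 2" | "m \<ge> 3" using assms(1) by linarith
        then show ?thesis by cases (use list in auto)
      qed
      then show "\<forall>j. ker_trivial (\<lambda>_. 1 :: 'k) ?L j \<or> coker_trivial (\<lambda>_. 1 :: 'k) ?L j"
        unfolding ker coker using ker_trivial_path by blast
    qed
  qed
  finally show ?thesis .
qed

end
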